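(* Let $(P,\leq)$ be a nonempty partially ordered set and $K$ a field. Define the function $$\phi:P\to\mathrm{Spec}(L_K(E_P))\quad\text{by}\quad \phi(p)=\langle E_P^0\setminus\mathcal{M}(v_p)\rangle\ \text{ for each }p\in P.$$ Then $\phi$ is (a well-defined function and) an order-embedding of $(P,\leq)$ into $(\mathrm{Spec}(L_K(E_P)),\subseteq)$. Moreover, $\phi$ is an order-isomorphism if and only if $(P,\leq)$ satisfies DCC.
   Context: Rings are associative, not necessarily unital. A prime ideal of a ring $R$ is a proper two-sided ideal $I$ such that for all $x,y\in R$, $xRy\subseteq I$ implies $x\in I$ or $y\in I$; $\mathrm{Spec}(R)$ is the set of prime ideals ordered by inclusion. $\langle X\rangle$ is the two-sided ideal generated by $X$. A directed graph $E=(E^0,E^1,\mathbf{s},\mathbf{r})$ has vertex set $E^0$, edge set $E^1$, and source and range maps $\mathbf{s},\mathbf{r}:E^1\to E^0$. A vertex $v$ is regular if $\mathbf{s}^{-1}(v)$ is finite and nonempty. For vertices $u,v$, $u\geq v$ means $u=v$ or there is a finite directed path from $u$ to $v$; $\mathcal{M}(v)=\{w\in E^0\mid w\geq v\}$. For a field $K$, the Leavitt path algebra $L_K(E)$ is the $K$-algebra generated by $\{v\mid v\in E^0\}\cup\{e,e^*\mid e\in E^1\}$ subject to: $vw=\delta_{v,w}v$; $\mathbf{s}(e)e=e\mathbf{r}(e)=e$; $\mathbf{r}(e)e^*=e^*\mathbf{s}(e)=e^*$; $e^*f=\delta_{e,f}\mathbf{r}(e)$; and $v=\sum_{e\in\mathbf{s}^{-1}(v)}ee^*$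 for every regular $v$. For a poset $(P,\leq)$, the graph $E_P$ has $E_P^0=\{v_p\mid p\in P\}$ and $E_P^1=\{e^i_{p,q}\mid i\in\mathbb{N},\ p,q\in P,\ p>q\}$ (with $\mathbb{N}=\{0,1,2,\dots\}$), where $\mathbf{s}(e^i_{p,q})=v_p$ and $\mathbf{r}(e^i_{p,q})=v_q$. A map $f$ between posets is an order-embedding if $x\leq y\Leftrightarrow f(x)\leq f(y)$; it is an order-isomorphism if moreover bijective. A poset satisfies DCC (descending chain condition) if it has no nonempty totally ordered subset without a minimal element. *)

theory Defs
  imports
    "HOL-Library.Poly_Mapping"
    "HOL-Algebra.QuotRing"
    "HOL-Algebra.Module"
    "Graph_Theory.Digraph"
begin

text \<open>
  Rings here need not be unital. They are carried by the records of HOL-Algebra, whose field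
  \<open>one\<close> is mandatory; no definition below depends on its value. The locales
  \<^locale>\<open>ideal\<close> and \<^locale>\<open>module\<close>, and with the former the function
  \<^const>\<open>genideal\<close>, presuppose a unit (and, for \<^locale>\<open>module\<close>, commutative scalars
  given by a record), so ideals are introduced without them.
\<close>

definition rng_ideal :: "'a set \<Rightarrow> ('a, 'm) ring_scheme \<Rightarrow> bool" where
  "rng_ideal I R \<longleftrightarrow>
     additive_subgroup I R \<and>
     (\<forall>a\<in>I. \<forall>r\<in>carrier R. r \<otimes>\<^bsub>R\<^esub> a \<in> I \<and> a \<otimes>\<^bsub>R\<^esub> r \<in> I)"

definition rng_ideal_gen :: "('a, 'm) ring_scheme \<Rightarrow> 'a set \<Rightarrow> 'a set" where
  "rng_ideal_gen R X = \<Inter> {I. rng_ideal I R \<and> X \<subseteq> I}"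

definition rng_prime_ideal :: "'a set \<Rightarrow> ('a, 'm) ring_scheme \<Rightarrow> bool" where
  "rng_prime_ideal I R \<longleftrightarrow>
     rng_ideal I R \<and> I \<noteq> carrier R \<and>
     (\<forall>x\<in>carrier R. \<forall>y\<in>carrier R.
        {x \<otimes>\<^bsub>R\<^esub> r \<otimes>\<^bsub>R\<^esub> y | r. r \<in> carrier R} \<subseteq> I \<longrightarrow> x \<in> I \<or> y \<in> I)"

definition rng_Spec :: "('a, 'm) ring_scheme \<Rightarrow> 'a set set" where
  "rng_Spec R = {I. rng_prime_ideal I R}"

text \<open>
  Algebras over a field, given as a type \<open>'k\<close>. In a non-unital algebra an ideal of the underlying
  ring need not be closed under scalar multiplication, so closure is demanded separately.
\<close>

definition alg_ideal :: "'a set \<Rightarrow> ('k, 'a, 'm) module_scheme \<Rightarrow> bool" where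
  "alg_ideal I A \<longleftrightarrow> rng_ideal I A \<and> (\<forall>c. \<forall>a\<in>I. c \<odot>\<^bsub>A\<^esub> a \<in> I)"

definition alg_ideal_gen :: "('k, 'a, 'm) module_scheme \<Rightarrow> 'a set \<Rightarrow> 'a set" where
  "alg_ideal_gen A X = \<Inter> {I. alg_ideal I A \<and> X \<subseteq> I}"

definition quot_alg :: "('k, 'a, 'm) module_scheme \<Rightarrow> 'a set \<Rightarrow> ('k, 'a set) module" where
  "quot_alg A I =
     ring.extend (A Quot I) (module.fields (\<lambda>c X. \<Union>a\<in>X. I +>\<^bsub>A\<^esub> (c \<odot>\<^bsub>A\<^esub> a)))"


text \<open>
  Words over an alphabet under concatenation, written additively so that
  \<open>'x free_monoid \<Rightarrow>\<^sub>0 'k\<close> carries the convolution product of the library; this product is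
  the multiplication of noncommutative polynomials.
\<close>

datatype 'x free_monoid = Word (letters: "'x list")

instantiation free_monoid :: (type) monoid_add
begin

definition "0 = Word []"

definition "u + v = Word (letters u @ letters v)"

instance
  by standard (simp_all add: zero_free_monoid_def plus_free_monoid_def)

end

text \<open>
  The free non-unital algebra on \<open>X\<close>: the polynomials in letters from \<open>X\<close> without constant term.
  In particular the (irrelevant) value of \<open>one\<close> does not lie in the carrier.
\<close>

definition free_algebra :: "'x set \<Rightarrow> ('k::field, 'x free_monoid \<Rightarrow>\<^sub>0 'k) module" where
  "free_algebra X =
     \<lparr>carrier = {f. \<forall>w\<in>Poly_Mapping.keys f. w \<noteq> 0 \<and> set (letters w) \<subseteq> X},
      mult = (*), one = 1, zero = 0, add = (+),
      smult = (\<lambda>c f. Poly_Mapping.single 0 c * f)\<rparr>"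

definition gen :: "'x \<Rightarrow> ('x free_monoid \<Rightarrow>\<^sub>0 'k::field)" where
  "gen x = Poly_Mapping.single (Word [x]) 1"


datatype ('v, 'e) lpa_gen = Vert 'v | Edge 'e | Ghost 'e

definition lpa_gens :: "('v, 'e) pre_digraph \<Rightarrow> ('v, 'e) lpa_gen set" where
  "lpa_gens E = Vert ` verts E \<union> Edge ` arcs E \<union> Ghost ` arcs E"

definition regular_vertex :: "('v, 'e) pre_digraph \<Rightarrow> 'v \<Rightarrow> bool" where
  "regular_vertex E v \<longleftrightarrow> v \<in> verts E \<and> finite (out_arcs E v) \<and> out_arcs E v \<noteq> {}"

text \<open>A relation \<open>l = r\<close> is recorded as the element \<open>l - r\<close> of the free algebra.\<close>

definition lpa_relations ::
    "('v, 'e) pre_digraph \<Rightarrow> (('v, 'e) lpa_gen free_monoid \<Rightarrow>\<^sub>0 'k::field) set" where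
  "lpa_relations E =
     {gen (Vert v) * gen (Vert w) - (if v = w then gen (Vert v) else 0) | v w.
        v \<in> verts E \<and> w \<in> verts E} \<union>
     {gen (Vert (tail E e)) * gen (Edge e) - gen (Edge e) | e. e \<in> arcs E} \<union>
     {gen (Edge e) * gen (Vert (head E e)) - gen (Edge e) | e. e \<in> arcs E} \<union>
     {gen (Vert (head E e)) * gen (Ghost e) - gen (Ghost e) | e. e \<in> arcs E} \<union>
     {gen (Ghost e) * gen (Vert (tail E e)) - gen (Ghost e) | e. e \<in> arcs E} \<union>
     {gen (Ghost e) * gen (Edge f) - (if e = f then gen (Vert (head E e)) else 0) | e f.
        e \<in> arcs E \<and> f \<in> arcs E} \<union>
     {gen (Vert v) - (\<Sum>e\<in>out_arcs E v. gen (Edge e) * gen (Ghost e)) | v.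
        regular_vertex E v}"

definition lpa_ideal ::
    "('v, 'e) pre_digraph \<Rightarrow> (('v, 'e) lpa_gen free_monoid \<Rightarrow>\<^sub>0 'k::field) set" where
  "lpa_ideal E = alg_ideal_gen (free_algebra (lpa_gens E)) (lpa_relations E)"

text \<open>
  The first argument of \<open>leavitt_path_algebra\<close>, of type \<^typ>\<open>'k itself\<close>, only selects the field.
\<close>

definition leavitt_path_algebra ::
    "'k::field itself \<Rightarrow> ('v, 'e) pre_digraph \<Rightarrow>
     ('k, (('v, 'e) lpa_gen free_monoid \<Rightarrow>\<^sub>0 'k) set) module" where
  "leavitt_path_algebra _ E = quot_alg (free_algebra (lpa_gens E)) (lpa_ideal E)"

definition lpa_vertex ::
    "('v, 'e) pre_digraph \<Rightarrow> 'v \<Rightarrow> (('v, 'e) lpa_gen free_monoid \<Rightarrow>\<^sub>0 'k::field) set" where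
  "lpa_vertex E v = lpa_ideal E +>\<^bsub>free_algebra (lpa_gens E)\<^esub> gen (Vert v)"


text \<open>\<open>w \<ge> v\<close> is \<open>w \<rightarrow>\<^sup>*\<^bsub>E\<^esub> v\<close>, which is reflexive on \<open>verts E\<close>.\<close>

definition vertices_above :: "('v, 'e) pre_digraph \<Rightarrow> 'v \<Rightarrow> 'v set" where
  "vertices_above E v = {w \<in> verts E. w \<rightarrow>\<^sup>*\<^bsub>E\<^esub> v}"

text \<open>
  A poset is a subset \<open>P\<close> of an ordered type with the induced order. The element \<open>p\<close> itself serves
  as the vertex \<open>v\<^sub>p\<close>, and the triple \<open>(i, p, q)\<close> as the edge number \<open>i\<close> from \<open>p\<close> to \<open>q\<close>.
\<close>

definition poset_graph :: "'p::order set \<Rightarrow> ('p, nat \<times> 'p \<times> 'p) pre_digraph" where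
  "poset_graph P =
     \<lparr>verts = P,
      arcs = {(i, p, q) | i p q. p \<in> P \<and> q \<in> P \<and> p > q},
      tail = (\<lambda>(i, p, q). p),
      head = (\<lambda>(i, p, q). q)\<rparr>"

definition poset_phi ::
    "'k::field itself \<Rightarrow> 'p::order set \<Rightarrow> 'p \<Rightarrow>
     (('p, nat \<times> 'p \<times> 'p) lpa_gen free_monoid \<Rightarrow>\<^sub>0 'k) set set" where
  "poset_phi K P p =
     rng_ideal_gen (leavitt_path_algebra K (poset_graph P))
       (lpa_vertex (poset_graph P) `
          (verts (poset_graph P) - vertices_above (poset_graph P) p))"

definition order_embedding_on :: "'a::order set \<Rightarrow> 'b::order set \<Rightarrow> ('a \<Rightarrow> 'b) \<Rightarrow> bool" where
  "order_embedding_on A B f \<longleftrightarrow>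
     f \<in> A \<rightarrow> B \<and> (\<forall>x\<in>A. \<forall>y\<in>A. x \<le> y \<longleftrightarrow> f x \<le> f y)"

definition order_isomorphism_on :: "'a::order set \<Rightarrow> 'b::order set \<Rightarrow> ('a \<Rightarrow> 'b) \<Rightarrow> bool" where
  "order_isomorphism_on A B f \<longleftrightarrow> order_embedding_on A B f \<and> bij_betw f A B"

definition DCC_on :: "'a::order set \<Rightarrow> bool" where
  "DCC_on P \<longleftrightarrow>
     \<not> (\<exists>C\<subseteq>P. C \<noteq> {} \<and> Complete_Partial_Order.chain (\<le>) C \<and>
          \<not> (\<exists>m\<in>C. \<forall>x\<in>C. \<not> x < m))"

end

theory Submission
  imports Defs "Graph_Theory.Arc_Walk" "HOL-Library.Sublist"
begin

text \<open>
  Idea. The graph of a poset has no regular vertices, so only the relations that identify a word with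
  another word or with \<open>0\<close> matter. Modulo them every element is a combination of the words
  \<open>\<alpha> w \<beta>\<^sup>*\<close> with \<open>\<alpha>\<close>, \<open>\<beta>\<close> paths ending at \<open>w\<close>. Let \<open>I\<close> be an ideal that contains all
  vertices outside the up-set of \<open>p\<close>. If \<open>f \<notin> I\<close>, take in the normal form of \<open>f\<close> a term
  \<open>\<alpha> w \<beta>\<^sup>*\<close> outside \<open>I\<close> with \<open>\<beta>\<close> as short as possible, and an edge \<open>u\<close> from \<open>w\<close> to \<open>p\<close> that does not
  occur in \<open>f\<close> (there are infinitely many; if \<open>w = p\<close>, the trivial path \<open>u\<close>). As the graph is
  acyclic, multiplying by \<open>u\<^sup>* \<alpha>\<^sup>*\<close> and \<open>\<beta> u\<close> kills all other terms, so that \<open>a f b \<equiv> p\<close> modulo \<open>I\<close> for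
  suitable \<open>a\<close>, \<open>b\<close>. Since \<open>p \<notin> \<phi>(p)\<close>, as the action on paths ending at \<open>p\<close> shows,
  \<open>\<phi>(p)\<close> is prime, and it is the only ideal that contains exactly the same vertices.

  The vertices outside a prime ideal form a nonempty down-directed set; under DCC it has a least
  element \<open>p\<close>, and the ideal is \<open>\<phi>(p)\<close>. Conversely, if a chain \<open>C\<close> has no least element, the
  intersection of all \<open>\<phi>(c)\<close> with \<open>c \<in> C\<close> is prime, but not of the form \<open>\<phi>(p)\<close>.
\<close>

section \<open>Ideals of non-unital rings and their quotients\<close>

locale nonunital_ring = abelian_group R for R (structure) +
  assumes m_closed [simp, intro]:
      "\<lbrakk>x \<in> carrier R; y \<in> carrier R\<rbrakk> \<Longrightarrow> x \<otimes> y \<in> carrier R"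
    and l_distr: "\<lbrakk>x \<in> carrier R; y \<in> carrier R; z \<in> carrier R\<rbrakk>
        \<Longrightarrow> (x \<oplus> y) \<otimes> z = x \<otimes> z \<oplus> y \<otimes> z"
    and r_distr: "\<lbrakk>x \<in> carrier R; y \<in> carrier R; z \<in> carrier R\<rbrakk>
        \<Longrightarrow> z \<otimes> (x \<oplus> y) = z \<otimes> x \<oplus> z \<otimes> y"
begin

text \<open>Closure under differences gives negatives as \<open>0 - x\<close> and sums as
  \<open>x - (- y)\<close>. In this form the axioms pass easily to intersections, images and
  preimages.\<close>

lemma rng_ideal_iff:
  "rng_ideal I R \<longleftrightarrow>
     I \<subseteq> carrier R \<and> \<zero> \<in> I \<and> (\<forall>x\<in>I. \<forall>y\<in>I. x \<ominus> y \<in> I) \<and>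
     (\<forall>a\<in>I. \<forall>r\<in>carrier R. r \<otimes> a \<in> I \<and> a \<otimes> r \<in> I)"
proof -
  have "additive_subgroup I R \<longleftrightarrow> I \<subseteq> carrier R \<and> \<zero> \<in> I \<and> (\<forall>x\<in>I. \<forall>y\<in>I. x \<ominus> y \<in> I)"
    (is "_ \<longleftrightarrow> ?I")
  proof
    assume "additive_subgroup I R"
    then interpret additive_subgroup I R .
    show ?I
      using a_subset zero_closed a_closed a_inv_closed by (auto simp: a_minus_def)
  next
    assume I: ?I
    have neg: "\<ominus> x \<in> I" if "x \<in> I" for x
    proof -
      have "\<zero> \<ominus> x \<in> I" using I that by blast
      moreover have "x \<in> carrier R" using I that by blast
      ultimately show ?thesis by (simp add: a_minus_def)
    qed
    have "x \<oplus> y \<in> I" if "x \<in> I" "y \<in> I" for x y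
    proof -
      have "x \<ominus> (\<ominus> y) \<in> I" using I that neg by blast
      moreover have "y \<in> carrier R" using I that by blast
      ultimately show ?thesis by (simp add: a_minus_def)
    qed
    then show "additive_subgroup I R"
      using I neg by (auto intro!: additive_subgroup.intro subgroup.intro simp: a_inv_def)
  qed
  then show ?thesis
    by (auto simp: rng_ideal_def)
qed

lemma rng_ideal_carrier: "rng_ideal (carrier R) R"
  by (auto simp: rng_ideal_iff)

lemma rng_idealD:
  assumes "rng_ideal I R"
  shows "I \<subseteq> carrier R" "\<zero> \<in> I" "\<And>x y. \<lbrakk>x \<in> I; y \<in> I\<rbrakk> \<Longrightarrow> x \<ominus> y \<in> I"
    "\<And>x y. \<lbrakk>x \<in> I; y \<in> I\<rbrakk> \<Longrightarrow> x \<oplus> y \<in> I"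
    "\<And>a r. \<lbrakk>a \<in> I; r \<in> carrier R\<rbrakk> \<Longrightarrow> r \<otimes> a \<in> I"
    "\<And>a r. \<lbrakk>a \<in> I; r \<in> carrier R\<rbrakk> \<Longrightarrow> a \<otimes> r \<in> I"
proof -
  have "additive_subgroup I R"
    using assms by (simp add: rng_ideal_def)
  then show "\<And>x y. \<lbrakk>x \<in> I; y \<in> I\<rbrakk> \<Longrightarrow> x \<oplus> y \<in> I"
    by (rule additive_subgroup.a_closed)
qed (use assms in \<open>simp_all add: rng_ideal_iff\<close>)

lemma rng_ideal_gen_ideal:
  assumes "X \<subseteq> carrier R"
  shows "rng_ideal (rng_ideal_gen R X) R"
proof -
  \<comment> \<open>The carrier is one of the ideals intersected; without such a member the
    intersection would be the whole type.\<close>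
  have "rng_ideal_gen R X \<subseteq> carrier R"
    using assms rng_ideal_carrier unfolding rng_ideal_gen_def by blast
  then show ?thesis
    unfolding rng_ideal_gen_def rng_ideal_iff[of "\<Inter> _"]
    by (auto dest: rng_idealD)
qed

end

lemma rng_ideal_gen_superset: "X \<subseteq> rng_ideal_gen R X"
  by (auto simp: rng_ideal_gen_def)

lemma rng_ideal_gen_least: "\<lbrakk>rng_ideal I R; X \<subseteq> I\<rbrakk> \<Longrightarrow> rng_ideal_gen R X \<subseteq> I"
  by (auto simp: rng_ideal_gen_def)

locale rng_quotient = nonunital_ring +
  fixes N
  assumes N_ideal: "rng_ideal N R"
begin

sublocale abelian_subgroup N R
  using N_ideal by (intro abelian_subgroupI3) (auto simp: rng_ideal_def abelian_group_axioms)

lemma coset_eq_iff: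
  assumes "x \<in> carrier R" "y \<in> carrier R"
  shows "N +> x = N +> y \<longleftrightarrow> x \<ominus> y \<in> N"
proof
  assume "N +> x = N +> y"
  then have "x \<in> N +> y"
    using a_rcos_self[OF assms(1)] by simp
  then show "x \<ominus> y \<in> N"
    using a_rcos_module[OF assms(2,1)] by (simp add: a_minus_def)
next
  assume "x \<ominus> y \<in> N"
  then have "x \<in> N +> y"
    using a_rcos_module[OF assms(2,1)] by (simp add: a_minus_def)
  then show "N +> x = N +> y"
    using a_repr_independence[OF _ assms(2) a_subgroup] by simp
qed

text \<open>\<open>rcoset_mult\<close> is the union of the cosets of all products of
  representatives. Since \<open>(i + x)(j + y)\<close> differs from \<open>x y\<close> by
  \<open>i (j + y) + x j\<close>, an element of \<open>N\<close>, that union is a single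
  coset.\<close>

lemma coset_mult:
  assumes x: "x \<in> carrier R" and y: "y \<in> carrier R"
  shows "rcoset_mult R N (N +> x) (N +> y) = N +> x \<otimes> y"
proof -
  have *: "N +> a \<otimes> b = N +> x \<otimes> y" if ab: "a \<in> N +> x" "b \<in> N +> y" for a b
  proof -
    obtain i j where ij: "i \<in> N" "j \<in> N" "a = i \<oplus> x" "b = j \<oplus> y"
      using ab by (auto simp: a_r_coset_def')
    have c: "i \<in> carrier R" "j \<in> carrier R"
      using ij a_subset by auto
    have eq: "a \<otimes> b = (i \<otimes> (j \<oplus> y) \<oplus> x \<otimes> j) \<oplus> x \<otimes> y"
      using c x y by (simp add: ij l_distr r_distr a_ac)
    have "i \<otimes> (j \<oplus> y) \<oplus> x \<otimes> j \<in> N"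
      using rng_idealD[OF N_ideal] ij c x y by auto
    then have "a \<otimes> b \<in> N +> x \<otimes> y"
      unfolding eq by (auto simp: a_r_coset_def')
    then show ?thesis
      using a_repr_independence[OF _ m_closed[OF x y] a_subgroup] by simp
  qed
  have "x \<in> N +> x" "y \<in> N +> y"
    using x y a_rcos_self by auto
  then show ?thesis
    unfolding rcoset_mult_def using * by blast
qed

lemma quot_simps:
  "carrier (R Quot N) = (+>) N ` carrier R" "\<zero>\<^bsub>R Quot N\<^esub> = N"
  by (auto simp: FactRing_simps)

lemma quot_add:
  "\<lbrakk>x \<in> carrier R; y \<in> carrier R\<rbrakk> \<Longrightarrow> (N +> x) \<oplus>\<^bsub>R Quot N\<^esub> (N +> y) = N +> x \<oplus> y"
  by (simp add: FactRing_def a_rcos_sum)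

lemma quot_mult:
  "\<lbrakk>x \<in> carrier R; y \<in> carrier R\<rbrakk> \<Longrightarrow> (N +> x) \<otimes>\<^bsub>R Quot N\<^esub> (N +> y) = N +> x \<otimes> y"
  by (simp add: FactRing_def coset_mult)

lemma coset_zero: "N +> \<zero> = N"
  using a_coset_add_zero a_subset by blast

lemma N_in_image: "\<zero> \<in> S \<Longrightarrow> N \<in> (+>) N ` S"
  by (rule image_eqI[where x = "\<zero>"]) (simp_all add: coset_zero)

lemma quot_nonunital_ring: "nonunital_ring (R Quot N)"
proof -
  interpret Q: abelian_group "R Quot N"
  proof (rule abelian_groupI)
    fix X assume "X \<in> carrier (R Quot N)"
    then obtain x where x: "x \<in> carrier R" "X = N +> x"
      by (auto simp: quot_simps)
    have "(N +> \<zero>) \<oplus>\<^bsub>R Quot N\<^esub> (N +> x) = N +> x"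
      using x by (simp add: quot_add del: coset_zero)
    then show "\<zero>\<^bsub>R Quot N\<^esub> \<oplus>\<^bsub>R Quot N\<^esub> X = X"
      by (simp add: x coset_zero quot_simps)
    have "(N +> \<ominus> x) \<oplus>\<^bsub>R Quot N\<^esub> (N +> x) = N"
      using x by (simp add: quot_add l_neg coset_zero)
    then show "\<exists>Y\<in>carrier (R Quot N). Y \<oplus>\<^bsub>R Quot N\<^esub> X = \<zero>\<^bsub>R Quot N\<^esub>"
      using x by (auto simp: quot_simps)
  qed (use a_subgroup in \<open>auto simp: quot_simps quot_add a_ac N_in_image\<close>)
  show ?thesis
    by unfold_locales (auto simp: quot_simps quot_add quot_mult l_distr r_distr)
qed

sublocale Q: nonunital_ring "R Quot N"
  by (rule quot_nonunital_ring)

lemma quot_minus: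
  assumes "x \<in> carrier R" "y \<in> carrier R"
  shows "(N +> x) \<ominus>\<^bsub>R Quot N\<^esub> (N +> y) = N +> x \<ominus> y"
proof -
  have "\<ominus>\<^bsub>R Quot N\<^esub> (N +> y) = N +> \<ominus> y"
    by (rule Q.minus_equality) (use assms in \<open>auto simp: quot_simps quot_add l_neg coset_zero\<close>)
  then show ?thesis
    using assms by (simp add: a_minus_def quot_add)
qed

text \<open>An ideal containing \<open>N\<close> is a union of cosets of \<open>N\<close>, so
  membership can be read off from the coset.\<close>

lemma coset_in_image_iff:
  assumes I: "rng_ideal I R" "N \<subseteq> I" and x: "x \<in> carrier R"
  shows "N +> x \<in> (+>) N ` I \<longleftrightarrow> x \<in> I"
proof
  assume "N +> x \<in> (+>) N ` I"
  then obtain y where y: "y \<in> I" "N +> x = N +> y"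
    by blast
  have yc: "y \<in> carrier R"
    using y rng_idealD(1)[OF I(1)] by blast
  have "x \<ominus> y \<in> I"
    using coset_eq_iff[OF x yc] y(2) I(2) by blast
  then have "(x \<ominus> y) \<oplus> y \<in> I"
    using rng_idealD(4)[OF I(1)] y(1) by blast
  then show "x \<in> I"
    using x yc by (simp add: a_minus_def a_assoc l_neg)
qed blast

lemma image_coset_subset_iff:
  assumes I: "rng_ideal I R" and J: "rng_ideal J R" "N \<subseteq> J"
  shows "(+>) N ` I \<subseteq> (+>) N ` J \<longleftrightarrow> I \<subseteq> J"
  using coset_in_image_iff[OF J] rng_idealD(1)[OF I] by blast

lemma rng_ideal_image:
  assumes I: "rng_ideal I R"
  shows "rng_ideal ((+>) N ` I) (R Quot N)"
proof -
  note D = rng_idealD[OF I]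
  have sub: "x \<in> carrier R" if "x \<in> I" for x
    using that D(1) by blast
  show ?thesis
    unfolding Q.rng_ideal_iff
    by (intro conjI ballI)
       (auto simp: quot_simps quot_minus quot_mult sub intro: D N_in_image)
qed

text \<open>Together with \<open>rng_ideal_image\<close> and \<open>coset_in_image_iff\<close>, this
  is the correspondence between ideals of the quotient and ideals of \<open>R\<close> containing
  \<open>N\<close>.\<close>

lemma rng_ideal_preimage:
  assumes J: "rng_ideal J (R Quot N)"
  shows "rng_ideal {x \<in> carrier R. N +> x \<in> J} R"
    "N \<subseteq> {x \<in> carrier R. N +> x \<in> J}"
    "(+>) N ` {x \<in> carrier R. N +> x \<in> J} = J"
proof -
  note D = Q.rng_idealD[OF J]
  have mult: "N +> r \<otimes> a \<in> J" "N +> a \<otimes> r \<in> J"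
    if "a \<in> carrier R" "N +> a \<in> J" "r \<in> carrier R" for a r
    using D(5,6)[OF that(2), of "N +> r"] that by (auto simp: quot_simps quot_mult)
  have minus: "N +> a \<ominus> b \<in> J"
    if "a \<in> carrier R" "N +> a \<in> J" "b \<in> carrier R" "N +> b \<in> J" for a b
    using D(3)[OF that(2,4)] that by (simp add: quot_minus)
  have N: "N \<in> J"
    using D(2) by (simp add: quot_simps)
  then have zero: "N +> \<zero> \<in> J"
    by (simp add: coset_zero)
  show "rng_ideal {x \<in> carrier R. N +> x \<in> J} R"
    unfolding rng_ideal_iff using mult minus zero by auto
  show "N \<subseteq> {x \<in> carrier R. N +> x \<in> J}"
  proof
    fix x assume x: "x \<in> N"
    then have xc: "x \<in> carrier R"
      using a_subset by blast
    have "N +> x = N +> \<zero>"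
      using x xc coset_eq_iff[OF xc a_Hcarr[OF rng_idealD(2)[OF N_ideal]]] by (simp add: a_minus_def)
    then show "x \<in> {x \<in> carrier R. N +> x \<in> J}"
      using xc zero by simp
  qed
  show "(+>) N ` {x \<in> carrier R. N +> x \<in> J} = J"
    using D(1) by (auto simp: quot_simps)
qed

text \<open>Because \<open>I\<close> is a union of cosets, properness, the products
  \<open>x r y\<close> and membership can all be compared through the quotient map.\<close>

lemma rng_prime_ideal_image_iff:
  assumes I: "rng_ideal I R" "N \<subseteq> I"
  shows "rng_prime_ideal ((+>) N ` I) (R Quot N) \<longleftrightarrow> rng_prime_ideal I R"
proof -
  note mem = coset_in_image_iff[OF I]
  have "(+>) N ` I = (+>) N ` carrier R \<longleftrightarrow> I = carrier R"
    using image_coset_subset_iff[OF rng_ideal_carrier I] rng_idealD(1)[OF I(1)] by blast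
  moreover have "{(N +> x) \<otimes>\<^bsub>R Quot N\<^esub> r \<otimes>\<^bsub>R Quot N\<^esub> (N +> y) | r. r \<in> (+>) N ` carrier R} =
      (+>) N ` {x \<otimes> r \<otimes> y | r. r \<in> carrier R}"
    if "x \<in> carrier R" "y \<in> carrier R" for x y
  proof -
    have "(N +> x) \<otimes>\<^bsub>R Quot N\<^esub> (N +> r) \<otimes>\<^bsub>R Quot N\<^esub> (N +> y) = N +> x \<otimes> r \<otimes> y"
      if "r \<in> carrier R" for r
      using that \<open>x \<in> _\<close> \<open>y \<in> _\<close> by (simp add: quot_mult)
    then show ?thesis
      by (auto simp: image_iff)
  qed
  moreover have "(+>) N ` {x \<otimes> r \<otimes> y | r. r \<in> carrier R} \<subseteq> (+>) N ` I \<longleftrightarrow>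
      {x \<otimes> r \<otimes> y | r. r \<in> carrier R} \<subseteq> I"
    if "x \<in> carrier R" "y \<in> carrier R" for x y
  proof -
    have "x \<otimes> r \<otimes> y \<in> carrier R" if "r \<in> carrier R" for r
      using that \<open>x \<in> _\<close> \<open>y \<in> _\<close> by blast
    then show ?thesis
      using mem by blast
  qed
  ultimately show ?thesis
    unfolding rng_prime_ideal_def quot_simps
    using I rng_ideal_image[OF I(1)] mem by simp
qed

lemma rng_Spec_quot:
  "rng_Spec (R Quot N) = (\<lambda>I. (+>) N ` I) ` {I \<in> rng_Spec R. N \<subseteq> I}"
proof (intro equalityI subsetI)
  fix J assume J: "J \<in> rng_Spec (R Quot N)"
  then have "rng_ideal J (R Quot N)"
    by (simp add: rng_Spec_def rng_prime_ideal_def)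
  note P = rng_ideal_preimage[OF this]
  show "J \<in> (\<lambda>I. (+>) N ` I) ` {I \<in> rng_Spec R. N \<subseteq> I}"
    using J rng_prime_ideal_image_iff[OF P(1,2)] P(2,3)
    by (intro image_eqI[where x = "{x \<in> carrier R. N +> x \<in> J}"]) (simp_all add: rng_Spec_def)
next
  fix J assume "J \<in> (\<lambda>I. (+>) N ` I) ` {I \<in> rng_Spec R. N \<subseteq> I}"
  then obtain I where I: "J = (+>) N ` I" "rng_prime_ideal I R" "N \<subseteq> I"
    by (auto simp: rng_Spec_def)
  then have "rng_ideal I R"
    by (simp add: rng_prime_ideal_def)
  then show "J \<in> rng_Spec (R Quot N)"
    using rng_prime_ideal_image_iff I by (simp add: rng_Spec_def)
qed

text \<open>Allows ideals given by generators to be handled upstairs, where \<open>N\<close> joins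
  the generators because the preimage of any ideal contains it.\<close>

lemma rng_ideal_gen_quot:
  assumes X: "X \<subseteq> carrier R"
  shows "rng_ideal_gen (R Quot N) ((+>) N ` X) = (+>) N ` rng_ideal_gen R (N \<union> X)"
proof
  have "rng_ideal (rng_ideal_gen R (N \<union> X)) R"
    using X a_subset by (intro rng_ideal_gen_ideal) auto
  then show "rng_ideal_gen (R Quot N) ((+>) N ` X) \<subseteq> (+>) N ` rng_ideal_gen R (N \<union> X)"
    using rng_ideal_gen_superset[of "N \<union> X" R]
    by (intro rng_ideal_gen_least rng_ideal_image) auto
next
  let ?J = "rng_ideal_gen (R Quot N) ((+>) N ` X)"
  have J: "rng_ideal ?J (R Quot N)"
    using X by (intro Q.rng_ideal_gen_ideal) (auto simp: quot_simps)
  note P = rng_ideal_preimage[OF J]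
  have "rng_ideal_gen R (N \<union> X) \<subseteq> {x \<in> carrier R. N +> x \<in> ?J}"
    using P(1,2) X rng_ideal_gen_superset[of "(+>) N ` X" "R Quot N"]
    by (intro rng_ideal_gen_least) auto
  then show "(+>) N ` rng_ideal_gen R (N \<union> X) \<subseteq> ?J"
    using P(3) by blast
qed

end

section \<open>Free algebras\<close>

abbreviation monom :: "'x list \<Rightarrow> 'k \<Rightarrow> ('x free_monoid \<Rightarrow>\<^sub>0 'k::zero)" where
  "monom w c \<equiv> Poly_Mapping.single (Word w) c"

lemma monom_mult: "monom u c * monom w d = monom (u @ w) (c * d)"
  by (simp add: mult_single plus_free_monoid_def)

text \<open>\<open>0\<close> is the empty word, so \<open>Poly_Mapping.single 0 c\<close> is the
  constant \<open>c\<close> and the product is a scalar multiple.\<close>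

lemma keys_scale: "Poly_Mapping.keys (Poly_Mapping.single 0 c * f) \<subseteq> Poly_Mapping.keys f"
  for f :: "'x free_monoid \<Rightarrow>\<^sub>0 'k::field"
  using keys_mult[of "Poly_Mapping.single 0 c" f]
  by (auto split: if_splits)

lemma free_algebra_simps:
  "mult (free_algebra X) = (*)" "zero (free_algebra X) = 0" "add (free_algebra X) = (+)"
  "smult (free_algebra X) = (\<lambda>c f. Poly_Mapping.single 0 c * f)"
  by (simp_all add: free_algebra_def)

lemma in_carrier_free_algebra:
  "f \<in> carrier (free_algebra X) \<longleftrightarrow>
     (\<forall>w\<in>Poly_Mapping.keys f. w \<noteq> 0 \<and> set (letters w) \<subseteq> X)"
  by (simp add: free_algebra_def)

lemma zero_in_free_algebra: "0 \<in> carrier (free_algebra X)"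
  by (simp add: in_carrier_free_algebra)

lemma add_in_free_algebra:
  "\<lbrakk>f \<in> carrier (free_algebra X); g \<in> carrier (free_algebra X)\<rbrakk> \<Longrightarrow> f + g \<in> carrier (free_algebra X)"
  unfolding in_carrier_free_algebra using Poly_Mapping.keys_add[of f g] by blast

lemma uminus_in_free_algebra:
  "f \<in> carrier (free_algebra X) \<Longrightarrow> - f \<in> carrier (free_algebra X)"
  by (simp add: in_carrier_free_algebra in_keys_iff)

lemma minus_in_free_algebra:
  "\<lbrakk>f \<in> carrier (free_algebra X); g \<in> carrier (free_algebra X)\<rbrakk> \<Longrightarrow> f - g \<in> carrier (free_algebra X)"
  using add_in_free_algebra[of f X "- g"] by (simp add: uminus_in_free_algebra)

lemma mult_in_free_algebra:
  assumes "f \<in> carrier (free_algebra X)" "g \<in> carrier (free_algebra X)"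
  shows "f * g \<in> carrier (free_algebra X)"
  unfolding in_carrier_free_algebra
proof
  fix w assume "w \<in> Poly_Mapping.keys (f * g)"
  then obtain u v where uv: "w = u + v" "u \<in> Poly_Mapping.keys f" "v \<in> Poly_Mapping.keys g"
    using keys_mult[of f g] by blast
  then have "u \<noteq> 0" "set (letters u) \<subseteq> X" "set (letters v) \<subseteq> X"
    using assms by (auto simp: in_carrier_free_algebra)
  then show "w \<noteq> 0 \<and> set (letters w) \<subseteq> X"
    unfolding uv by (cases u) (auto simp: zero_free_monoid_def plus_free_monoid_def)
qed

lemma scale_in_free_algebra:
  "f \<in> carrier (free_algebra X) \<Longrightarrow> Poly_Mapping.single 0 c * f \<in> carrier (free_algebra X)"
  using keys_scale[of c f] by (auto simp: in_carrier_free_algebra)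

lemma monom_in_free_algebra:
  "\<lbrakk>w \<noteq> []; set w \<subseteq> X\<rbrakk> \<Longrightarrow> monom w c \<in> carrier (free_algebra X)"
  by (auto simp: in_carrier_free_algebra zero_free_monoid_def)

lemma sum_in_free_algebra:
  "(\<And>i. i \<in> S \<Longrightarrow> f i \<in> carrier (free_algebra X)) \<Longrightarrow> sum f S \<in> carrier (free_algebra X)"
  by (induction S rule: infinite_finite_induct) (auto simp: zero_in_free_algebra add_in_free_algebra)

lemmas free_algebra_closed =
  zero_in_free_algebra add_in_free_algebra uminus_in_free_algebra minus_in_free_algebra
  mult_in_free_algebra scale_in_free_algebra sum_in_free_algebra

lemma poly_mapping_sum_monoms:
  fixes f :: "'x free_monoid \<Rightarrow>\<^sub>0 'k::field"
  shows "f = (\<Sum>w\<in>Poly_Mapping.keys f. Poly_Mapping.single w (Poly_Mapping.lookup f w))"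
proof (rule poly_mapping_eqI)
  fix w
  have "Poly_Mapping.lookup (\<Sum>v\<in>Poly_Mapping.keys f. Poly_Mapping.single v (Poly_Mapping.lookup f v)) w =
     (\<Sum>v\<in>Poly_Mapping.keys f. if v = w then Poly_Mapping.lookup f v else 0)"
    unfolding lookup_sum lookup_single when_def ..
  also have "\<dots> = Poly_Mapping.lookup f w"
    by (simp add: in_keys_iff)
  finally show "Poly_Mapping.lookup f w = Poly_Mapping.lookup (\<Sum>v\<in>Poly_Mapping.keys f. Poly_Mapping.single v (Poly_Mapping.lookup f v)) w"
    by (rule sym)
qed

lemma free_algebra_nonunital_ring: "nonunital_ring (free_algebra X)"
proof -
  interpret abelian_group "free_algebra X"
    by (rule abelian_groupI)
       (auto simp: free_algebra_simps free_algebra_closed algebra_simps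
          intro!: bexI[of _ "- _"] uminus_in_free_algebra)
  show ?thesis
    by unfold_locales (auto simp: free_algebra_simps free_algebra_closed algebra_simps)
qed

interpretation free_algebra: nonunital_ring "free_algebra X"
  by (rule free_algebra_nonunital_ring)

lemma free_algebra_minus:
  assumes "f \<in> carrier (free_algebra X)" "g \<in> carrier (free_algebra X)"
  shows "f \<ominus>\<^bsub>free_algebra X\<^esub> g = f - g"
proof -
  have "\<ominus>\<^bsub>free_algebra X\<^esub> g = - g"
    using assms(2) by (intro free_algebra.minus_equality) (auto simp: free_algebra_simps free_algebra_closed)
  then show ?thesis
    by (simp add: a_minus_def free_algebra_simps)
qed

lemma rng_ideal_free_algebra_iff:
  "rng_ideal I (free_algebra X) \<longleftrightarrow>
     I \<subseteq> carrier (free_algebra X) \<and> 0 \<in> I \<and> (\<forall>x\<in>I. \<forall>y\<in>I. x - y \<in> I) \<and>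
     (\<forall>a\<in>I. \<forall>r\<in>carrier (free_algebra X). r * a \<in> I \<and> a * r \<in> I)"
proof -
  have "x \<ominus>\<^bsub>free_algebra X\<^esub> y = x - y"
    if "I \<subseteq> carrier (free_algebra X)" "x \<in> I" "y \<in> I" for x y
    using that by (intro free_algebra_minus) auto
  then show ?thesis
    unfolding free_algebra.rng_ideal_iff free_algebra_simps by auto
qed

lemma rng_ideal_free_algebraD:
  assumes "rng_ideal I (free_algebra X)"
  shows "I \<subseteq> carrier (free_algebra X)"
    "\<And>x y. \<lbrakk>x \<in> I; y \<in> I\<rbrakk> \<Longrightarrow> x + y \<in> I"
    "\<And>x y. \<lbrakk>x \<in> I; y \<in> I\<rbrakk> \<Longrightarrow> x - y \<in> I"
    "\<And>a r. \<lbrakk>a \<in> I; r \<in> carrier (free_algebra X)\<rbrakk> \<Longrightarrow> r * a \<in> I"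
    "\<And>a r. \<lbrakk>a \<in> I; r \<in> carrier (free_algebra X)\<rbrakk> \<Longrightarrow> a * r \<in> I"
proof -
  show "\<And>x y. \<lbrakk>x \<in> I; y \<in> I\<rbrakk> \<Longrightarrow> x + y \<in> I"
    using free_algebra.rng_idealD(4)[OF assms] by (simp add: free_algebra_simps)
qed (use assms in \<open>simp_all add: rng_ideal_free_algebra_iff\<close>)

lemma rng_ideal_sum:
  assumes "rng_ideal I (free_algebra X)" "\<And>i. i \<in> S \<Longrightarrow> f i \<in> I"
  shows "sum f S \<in> I"
proof -
  have "0 \<in> I"
    using assms(1) by (simp add: rng_ideal_free_algebra_iff)
  then show ?thesis
    using assms(2) rng_ideal_free_algebraD(2)[OF assms(1)]
    by (induction S rule: infinite_finite_induct) auto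
qed

lemma alg_ideal_gen_ideal:
  fixes Y :: "('x free_monoid \<Rightarrow>\<^sub>0 'k::field) set"
  assumes "Y \<subseteq> carrier (free_algebra X)"
  shows "alg_ideal (alg_ideal_gen (free_algebra X) Y) (free_algebra X)"
proof -
  let ?F = "free_algebra X :: ('k, 'x free_monoid \<Rightarrow>\<^sub>0 'k) module"
  have "alg_ideal (carrier ?F) ?F"
    by (auto simp: alg_ideal_def free_algebra.rng_ideal_carrier free_algebra_simps scale_in_free_algebra)
  then have "alg_ideal_gen ?F Y \<subseteq> carrier ?F"
    using assms by (auto simp: alg_ideal_gen_def)
  then show ?thesis
    unfolding alg_ideal_gen_def alg_ideal_def rng_ideal_free_algebra_iff by auto
qed

section \<open>Words modulo the Leavitt relations\<close>

locale lpa = wf_digraph G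
  for G :: "('a, 'b) pre_digraph" and K :: "'k::field itself"
begin

text \<open>Letters are read as arrows of the doubled graph, with ghosts running backwards: modulo
  the relations, \<open>letter_src x\<close> and \<open>letter_tgt x\<close> are vertices acting as
  left and right identity on \<open>x\<close>.\<close>

fun letter_src :: "('a, 'b) lpa_gen \<Rightarrow> 'a" where
  "letter_src (Vert v) = v"
| "letter_src (Edge e) = tail G e"
| "letter_src (Ghost e) = head G e"

fun letter_tgt :: "('a, 'b) lpa_gen \<Rightarrow> 'a" where
  "letter_tgt (Vert v) = v"
| "letter_tgt (Edge e) = head G e"
| "letter_tgt (Ghost e) = tail G e"

abbreviation lpa_words :: "('a, 'b) lpa_gen list set" where
  "lpa_words \<equiv> {w. set w \<subseteq> lpa_gens G}"

definition lpa_cong ::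
    "(('a, 'b) lpa_gen free_monoid \<Rightarrow>\<^sub>0 'k) \<Rightarrow> (('a, 'b) lpa_gen free_monoid \<Rightarrow>\<^sub>0 'k) \<Rightarrow> bool"
    (infix \<open>\<approx>\<close> 50)
  where "f \<approx> g \<longleftrightarrow> f - g \<in> lpa_ideal G"

lemma lpa_relations_carrier:
  "(lpa_relations G :: (('a, 'b) lpa_gen free_monoid \<Rightarrow>\<^sub>0 'k) set)
     \<subseteq> carrier (free_algebra (lpa_gens G))"
proof -
  have gen: "gen x \<in> carrier (free_algebra (lpa_gens G))" if "x \<in> lpa_gens G" for x
    using that by (simp add: gen_def monom_in_free_algebra)
  have arc: "Edge e \<in> lpa_gens G" "Ghost e \<in> lpa_gens G" "Vert (tail G e) \<in> lpa_gens G"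
    "Vert (head G e) \<in> lpa_gens G" if "e \<in> arcs G" for e
    using that by (auto simp: lpa_gens_def)
  have vert: "Vert v \<in> lpa_gens G" if "v \<in> verts G" for v
    using that by (auto simp: lpa_gens_def)
  show ?thesis
    unfolding lpa_relations_def
    by (auto simp: regular_vertex_def out_arcs_def intro!: free_algebra_closed gen arc vert)
qed

lemma alg_ideal_lpa_ideal:
  "alg_ideal (lpa_ideal G) (free_algebra (lpa_gens G) :: ('k, _) module)"
  unfolding lpa_ideal_def by (rule alg_ideal_gen_ideal[OF lpa_relations_carrier])

lemma rng_ideal_lpa_ideal:
  "rng_ideal (lpa_ideal G) (free_algebra (lpa_gens G) :: ('k, _) module)"
  using alg_ideal_lpa_ideal by (simp add: alg_ideal_def)

lemma lpa_relations_subset: "(lpa_relations G :: (('a, 'b) lpa_gen free_monoid \<Rightarrow>\<^sub>0 'k) set) \<subseteq> lpa_ideal G"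
  by (auto simp: lpa_ideal_def alg_ideal_gen_def)

text \<open>The empty word gives a constant, which lies outside the non-unital algebra. On the left
  this case rests on closure under scalars; on the right the coefficient is \<open>1\<close> and the
  factor is the identity.\<close>

lemma lpa_ideal_mult:
  fixes c :: 'k
  assumes "f \<in> lpa_ideal G" "w \<in> lpa_words"
  shows "monom w c * f \<in> lpa_ideal G" "f * monom w 1 \<in> lpa_ideal G"
proof -
  show "monom w c * f \<in> lpa_ideal G"
  proof (cases "w = []")
    case True
    then show ?thesis
      using alg_ideal_lpa_ideal assms(1)
      by (simp add: alg_ideal_def free_algebra_simps zero_free_monoid_def)
  next
    case False
    then show ?thesis
      using rng_ideal_lpa_ideal assms by (simp add: rng_ideal_free_algebra_iff monom_in_free_algebra)
  qed
  show "f * monom w 1 \<in> lpa_ideal G"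
  proof (cases "w = []")
    case True
    then show ?thesis
      using assms(1) by (simp add: zero_free_monoid_def[symmetric])
  next
    case False
    then show ?thesis
      using rng_ideal_lpa_ideal assms by (simp add: rng_ideal_free_algebra_iff monom_in_free_algebra)
  qed
qed

lemma lpa_cong_refl [simp, intro]: "f \<approx> f"
  using rng_ideal_lpa_ideal by (simp add: lpa_cong_def rng_ideal_free_algebra_iff)

lemma lpa_cong_sym: "f \<approx> g \<Longrightarrow> g \<approx> f"
proof -
  assume "f \<approx> g"
  then have "0 - (f - g) \<in> lpa_ideal G"
    using rng_ideal_lpa_ideal unfolding lpa_cong_def rng_ideal_free_algebra_iff by blast
  then show ?thesis
    by (simp add: lpa_cong_def)
qed

lemma lpa_cong_trans [trans]: "\<lbrakk>f \<approx> g; g \<approx> h\<rbrakk> \<Longrightarrow> f \<approx> h"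
proof -
  assume "f \<approx> g" "g \<approx> h"
  then have "(f - g) - (h - g) \<in> lpa_ideal G"
    using rng_ideal_lpa_ideal lpa_cong_sym unfolding lpa_cong_def rng_ideal_free_algebra_iff by blast
  then show ?thesis
    by (simp add: lpa_cong_def)
qed

text \<open>Multiplying a congruence by words on both sides turns it into a rewrite rule inside
  longer words; the later reductions of words are built from it.\<close>

lemma lpa_cong_ctx:
  assumes "monom l 1 \<approx> f" "u \<in> lpa_words" "v \<in> lpa_words"
  shows "monom (u @ l @ v) c \<approx> monom u c * f * monom v 1"
proof -
  have "monom u c * (monom l 1 - f) * monom v 1 \<in> lpa_ideal G"
    using assms by (intro lpa_ideal_mult) (auto simp: lpa_cong_def)
  then show ?thesis
    by (simp add: lpa_cong_def algebra_simps monom_mult)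
qed

lemma lpa_cong_ctx_monom:
  fixes c :: 'k
  assumes "monom l 1 \<approx> monom r 1" "u \<in> lpa_words" "v \<in> lpa_words"
  shows "monom (u @ l @ v) c \<approx> monom (u @ r @ v) c"
  using lpa_cong_ctx[OF assms, of c] by (simp add: monom_mult)

lemma lpa_cong_ctx_zero:
  fixes c :: 'k
  assumes "monom l 1 \<approx> 0" "u \<in> lpa_words" "v \<in> lpa_words"
  shows "monom (u @ l @ v) c \<approx> 0"
  using lpa_cong_ctx[OF assms, of c] by simp

lemma lpa_gens_iff [simp]:
  "Vert v \<in> lpa_gens G \<longleftrightarrow> v \<in> verts G"
  "Edge e \<in> lpa_gens G \<longleftrightarrow> e \<in> arcs G"
  "Ghost e \<in> lpa_gens G \<longleftrightarrow> e \<in> arcs G"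
  by (auto simp: lpa_gens_def)

lemma vert_vert: "\<lbrakk>v \<in> verts G; w \<in> verts G\<rbrakk> \<Longrightarrow>
    monom [Vert v, Vert w] 1 \<approx> (if v = w then monom [Vert v] 1 else 0)"
proof -
  assume "v \<in> verts G" "w \<in> verts G"
  then have "gen (Vert v) * gen (Vert w) - (if v = w then gen (Vert v) else 0) \<in> lpa_relations G"
    unfolding lpa_relations_def by blast
  then have "gen (Vert v) * gen (Vert w) \<approx> (if v = w then gen (Vert v) else 0)"
    using lpa_relations_subset by (auto simp: lpa_cong_def)
  then show ?thesis
    by (simp add: gen_def monom_mult split: if_splits)
qed

lemma ghost_edge: "\<lbrakk>e \<in> arcs G; f \<in> arcs G\<rbrakk> \<Longrightarrow>
    monom [Ghost e, Edge f] 1 \<approx> (if e = f then monom [Vert (head G e)] 1 else 0)"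
proof -
  assume "e \<in> arcs G" "f \<in> arcs G"
  then have "gen (Ghost e) * gen (Edge f) - (if e = f then gen (Vert (head G e)) else 0) \<in> lpa_relations G"
    unfolding lpa_relations_def by blast
  then have "gen (Ghost e) * gen (Edge f) \<approx> (if e = f then gen (Vert (head G e)) else 0)"
    using lpa_relations_subset by (auto simp: lpa_cong_def)
  then show ?thesis
    by (simp add: gen_def monom_mult split: if_splits)
qed

lemma src_letter:
  assumes "x \<in> lpa_gens G"
  shows "monom [Vert (letter_src x), x] 1 \<approx> monom [x] 1"
proof (cases x)
  case (Vert v)
  then show ?thesis
    using assms vert_vert[of v v] by simp
next
  case (Edge e)
  then have "gen (Vert (tail G e)) * gen (Edge e) - gen (Edge e) \<in> lpa_relations G"
    using assms unfolding lpa_relations_def by auto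
  then show ?thesis
    using lpa_relations_subset Edge by (auto simp: lpa_cong_def gen_def monom_mult)
next
  case (Ghost e)
  then have "gen (Vert (head G e)) * gen (Ghost e) - gen (Ghost e) \<in> lpa_relations G"
    using assms unfolding lpa_relations_def by auto
  then show ?thesis
    using lpa_relations_subset Ghost by (auto simp: lpa_cong_def gen_def monom_mult)
qed

lemma tgt_letter:
  assumes "x \<in> lpa_gens G"
  shows "monom [x, Vert (letter_tgt x)] 1 \<approx> monom [x] 1"
proof (cases x)
  case (Vert v)
  then show ?thesis
    using assms vert_vert[of v v] by simp
next
  case (Edge e)
  then have "gen (Edge e) * gen (Vert (head G e)) - gen (Edge e) \<in> lpa_relations G"
    using assms unfolding lpa_relations_def by auto
  then show ?thesis
    using lpa_relations_subset Edge by (auto simp: lpa_cong_def gen_def monom_mult)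
next
  case (Ghost e)
  then have "gen (Ghost e) * gen (Vert (tail G e)) - gen (Ghost e) \<in> lpa_relations G"
    using assms unfolding lpa_relations_def by auto
  then show ?thesis
    using lpa_relations_subset Ghost by (auto simp: lpa_cong_def gen_def monom_mult)
qed

lemma letter_src_verts: "x \<in> lpa_gens G \<Longrightarrow> letter_src x \<in> verts G"
  and letter_tgt_verts: "x \<in> lpa_gens G \<Longrightarrow> letter_tgt x \<in> verts G"
  by (cases x; simp)+

lemma word_src:
  assumes "x \<in> lpa_gens G" "u \<in> lpa_words" "z \<in> lpa_words"
  shows "monom (u @ Vert (letter_src x) # x # z) c \<approx> monom (u @ x # z) c"
  using lpa_cong_ctx_monom[OF src_letter, of x u z c] assms by simp

lemma word_tgt:
  assumes "x \<in> lpa_gens G" "u \<in> lpa_words" "z \<in> lpa_words"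
  shows "monom (u @ x # Vert (letter_tgt x) # z) c \<approx> monom (u @ x # z) c"
  using lpa_cong_ctx_monom[OF tgt_letter, of x u z c] assms by simp

lemma word_ghost_edge:
  assumes "e \<in> arcs G" "u \<in> lpa_words" "z \<in> lpa_words"
  shows "monom (u @ Ghost e # Edge e # z) c \<approx> monom (u @ Vert (head G e) # z) c"
  using lpa_cong_ctx_monom[of "[Ghost e, Edge e]" "[Vert (head G e)]" u z c] ghost_edge[of e e] assms
  by simp

lemma word_ghost_edge_zero:
  assumes "e \<in> arcs G" "f \<in> arcs G" "e \<noteq> f" "u \<in> lpa_words" "z \<in> lpa_words"
  shows "monom (u @ Ghost e # Edge f # z) c \<approx> 0"
  using lpa_cong_ctx_zero[of "[Ghost e, Edge f]" u z c] ghost_edge[of e f] assms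
  by simp

text \<open>Insert the target of \<open>x\<close> and the source of \<open>y\<close> between the two
  letters; distinct vertices are orthogonal idempotents.\<close>

lemma word_zero:
  assumes "x \<in> lpa_gens G" "y \<in> lpa_gens G" "letter_tgt x \<noteq> letter_src y"
    "u \<in> lpa_words" "z \<in> lpa_words"
  shows "monom (u @ x # y # z) c \<approx> 0"
proof -
  let ?v = "Vert (letter_tgt x)" and ?w = "Vert (letter_src y)"
  have v: "letter_tgt x \<in> verts G" and w: "letter_src y \<in> verts G"
    using assms letter_src_verts letter_tgt_verts by auto
  have "monom (u @ x # y # z) c \<approx> monom (u @ x # ?v # y # z) c"
    using word_tgt[of x u "y # z" c] assms by (auto intro: lpa_cong_sym)
  also have "\<dots> \<approx> monom (u @ x # ?v # ?w # y # z) c"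
    using word_src[of y "u @ [x, ?v]" z c] assms v by (auto intro: lpa_cong_sym)
  also have "\<dots> \<approx> 0"
    using lpa_cong_ctx_zero[of "[?v, ?w]" "u @ [x]" "y # z" c] vert_vert[OF v w] assms by simp
  finally show ?thesis .
qed

lemma walk_word:
  "awalk v \<alpha> w \<Longrightarrow> set (map Edge \<alpha>) \<subseteq> lpa_gens G"
  "awalk v \<alpha> w \<Longrightarrow> set (map Ghost (rev \<alpha>)) \<subseteq> lpa_gens G"
  "awalk v \<alpha> w \<Longrightarrow> v \<in> verts G" "awalk v \<alpha> w \<Longrightarrow> w \<in> verts G"
  by (auto dest: awalk_hd_in_verts awalk_last_in_verts) (auto simp: awalk_def)

text \<open>The first edge absorbs \<open>v\<close>. If the path is trivial, then
  \<open>v = w\<close> and the trailing \<open>Vert w\<close> absorbs it, which is why that letter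
  is carried along.\<close>

lemma word_absorb_src:
  assumes "awalk v \<alpha> w" "u \<in> lpa_words" "z \<in> lpa_words"
  shows "monom (u @ Vert v # map Edge \<alpha> @ Vert w # z) c \<approx> monom (u @ map Edge \<alpha> @ Vert w # z) c"
proof (cases \<alpha>)
  case Nil
  then show ?thesis
    using assms word_src[of "Vert w" u z c] by (auto simp: awalk_Nil_iff)
next
  case (Cons e \<alpha>')
  then have e: "e \<in> arcs G" "tail G e = v" and \<alpha>': "awalk (head G e) \<alpha>' w"
    using assms(1) by (auto simp: awalk_Cons_iff)
  then show ?thesis
    using word_src[of "Edge e" u "map Edge \<alpha>' @ Vert w # z" c] assms(2,3) walk_word[OF \<alpha>'] Cons
    by simp
qed

text \<open>This is \<open>\<alpha>^* \<alpha> = w\<close>. The innermost pair belongs to the first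
  edge: it collapses to a vertex, which the rest of \<open>\<alpha>\<close> absorbs.\<close>

lemma word_ghost_walk_walk:
  assumes "awalk v \<alpha> w" "u \<in> lpa_words" "z \<in> lpa_words"
  shows "monom (u @ Vert w # map Ghost (rev \<alpha>) @ map Edge \<alpha> @ Vert w # z) c \<approx>
    monom (u @ Vert w # z) c"
  using assms(1)
proof (induction \<alpha> arbitrary: v)
  case Nil
  then show ?case
    using assms(2,3) word_src[of "Vert w" u z c] by (auto simp: awalk_Nil_iff)
next
  case (Cons e \<alpha>)
  then have e: "e \<in> arcs G" "tail G e = v" and \<alpha>: "awalk (head G e) \<alpha> w"
    by (auto simp: awalk_Cons_iff)
  let ?u = "u @ Vert w # map Ghost (rev \<alpha>)" and ?z = "map Edge \<alpha> @ Vert w # z"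
  have words: "?u \<in> lpa_words" "?z \<in> lpa_words"
    using assms(2,3) walk_word[OF \<alpha>] by auto
  have "monom (?u @ Ghost e # Edge e # ?z) c \<approx> monom (?u @ Vert (head G e) # ?z) c"
    using word_ghost_edge e words by blast
  also have "\<dots> \<approx> monom (?u @ ?z) c"
    using word_absorb_src[OF \<alpha> words(1) assms(3)] .
  also have "\<dots> \<approx> monom (u @ Vert w # z) c"
    using Cons.IH[OF \<alpha>] by simp
  finally show ?case
    by simp
qed

text \<open>This is \<open>\<alpha>^* \<beta> = 0\<close> for incomparable paths. Common first edges
  cancel from the inside until two distinct edges meet and give \<open>0\<close>; where a path is
  exhausted, incomparability forces a mismatch of vertices.\<close>

lemma word_ghost_walk_walk_zero:
  assumes "awalk v \<alpha> w" "awalk v' \<beta> w'" "\<not> (v = v' \<and> (prefix \<alpha> \<beta> \<or> prefix \<beta> \<alpha>))"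
    "u \<in> lpa_words" "z \<in> lpa_words"
  shows "monom (u @ Vert w # map Ghost (rev \<alpha>) @ map Edge \<beta> @ Vert w' # z) c \<approx> 0"
  using assms(1-3)
proof (induction \<alpha> arbitrary: v v' \<beta>)
  case Nil
  then have v: "v = w" "w \<in> verts G" "v' \<noteq> w"
    by (auto simp: awalk_Nil_iff)
  show ?case
  proof (cases \<beta>)
    case Nil
    then show ?thesis
      using \<open>awalk v' \<beta> w'\<close> v word_zero[of "Vert w" "Vert w'" u z c] assms(4,5)
      by (auto simp: awalk_Nil_iff)
  next
    case (Cons f \<beta>')
    then have f: "f \<in> arcs G" "tail G f = v'" and \<beta>': "awalk (head G f) \<beta>' w'"
      using \<open>awalk v' \<beta> w'\<close> by (auto simp: awalk_Cons_iff)
    then show ?thesis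
      using v word_zero[of "Vert w" "Edge f" u "map Edge \<beta>' @ Vert w' # z" c] assms(4,5)
        walk_word[OF \<beta>'] Cons
      by simp
  qed
next
  case (Cons e \<alpha>)
  then have e: "e \<in> arcs G" "tail G e = v" and \<alpha>: "awalk (head G e) \<alpha> w"
    by (auto simp: awalk_Cons_iff)
  let ?u = "u @ Vert w # map Ghost (rev \<alpha>)"
  have u: "?u \<in> lpa_words"
    using assms(4,5) walk_word[OF \<alpha>] by auto
  show ?case
  proof (cases \<beta>)
    case Nil
    then show ?thesis
      using Cons.prems e u word_zero[of "Ghost e" "Vert w'" ?u z c] assms(5)
      by (auto simp: awalk_Nil_iff)
  next
    case \<beta>: (Cons f \<beta>')
    then have f: "f \<in> arcs G" "tail G f = v'" and \<beta>': "awalk (head G f) \<beta>' w'"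
      using Cons.prems by (auto simp: awalk_Cons_iff)
    let ?z = "map Edge \<beta>' @ Vert w' # z"
    have z: "?z \<in> lpa_words"
      using assms(5) walk_word[OF \<beta>'] by auto
    have "monom (?u @ Ghost e # Edge f # ?z) c \<approx> 0"
    proof (cases "e = f")
      case True
      have "monom (?u @ Ghost e # Edge f # ?z) c \<approx> monom (?u @ Vert (head G f) # ?z) c"
        using word_ghost_edge e u z True by blast
      also have "\<dots> \<approx> monom (?u @ ?z) c"
        using word_absorb_src[OF \<beta>' u assms(5)] .
      also have "\<dots> \<approx> 0"
        using Cons.IH[OF \<alpha> \<beta>'] Cons.prems(3) \<beta> e f True by auto
      finally show ?thesis .
    next
      case False
      then show ?thesis
        using word_ghost_edge_zero e f u z by blast
    qed
    then show ?thesis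
      by (simp add: \<beta>)
  qed
qed

end

section \<open>Normal forms\<close>

context lpa
begin

lemma awalk_append_right:
  assumes "awalk v \<alpha> w" "awalk v (\<alpha> @ \<rho>) w'"
  shows "awalk w \<rho> w'"
proof -
  have "awlast v \<alpha> = w"
    using assms(1) by simp
  then show ?thesis
    using assms(2) by simp
qed

lemma awalk_appendI:
  assumes "awalk v \<alpha> w" "awalk w \<rho> w'"
  shows "awalk v (\<alpha> @ \<rho>) w'"
proof -
  have "awlast v \<alpha> = w"
    using assms(1) by simp
  then show ?thesis
    using assms by simp
qed

text \<open>The middle vertex is kept as a letter so that the word is nonempty even if both paths
  are trivial, as an algebra without constant terms demands.\<close>

fun lpa_word :: "'b list \<times> 'a \<times> 'b list \<Rightarrow> ('a, 'b) lpa_gen list" where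
  "lpa_word (\<alpha>, w, \<beta>) = map Edge \<alpha> @ Vert w # map Ghost (rev \<beta>)"

definition lpa_indices :: "('b list \<times> 'a \<times> 'b list) set" where
  "lpa_indices = {(\<alpha>, w, \<beta>). (\<exists>v. awalk v \<alpha> w) \<and> (\<exists>v. awalk v \<beta> w)}"

definition reducible :: "('a, 'b) lpa_gen list \<Rightarrow> bool" where
  "reducible x \<longleftrightarrow> (\<forall>c. monom x c \<approx> 0) \<or>
     (\<exists>t\<in>lpa_indices. \<forall>c. monom x c \<approx> monom (lpa_word t) c)"

lemma lpa_word_words:
  assumes "t \<in> lpa_indices"
  shows "set (lpa_word t) \<subseteq> lpa_gens G"
proof -
  obtain \<alpha> w \<beta> v v' where t: "t = (\<alpha>, w, \<beta>)" and "awalk v \<alpha> w" "awalk v' \<beta> w"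
    using assms by (auto simp: lpa_indices_def)
  then show ?thesis
    using walk_word[of v \<alpha> w] walk_word[of v' \<beta> w] by simp
qed

lemma reducible_lpa_word: "t \<in> lpa_indices \<Longrightarrow> reducible (lpa_word t)"
  by (auto simp: reducible_def)

lemma reducible_cong:
  assumes "\<And>c. monom x c \<approx> monom y c" "reducible y"
  shows "reducible x"
  using assms lpa_cong_trans unfolding reducible_def by meson

text \<open>Exposes the first letter, so that \<open>word_zero\<close> can compare its source with a
  letter placed in front.\<close>

lemma lpa_word_Cons:
  assumes "awalk v \<alpha> w" "awalk v' \<beta> w"
  obtains y z where "lpa_word (\<alpha>, w, \<beta>) = y # z" "letter_src y = v" "y \<in> lpa_gens G" "z \<in> lpa_words"
proof -
  have "(\<alpha>, w, \<beta>) \<in> lpa_indices"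
    using assms by (auto simp: lpa_indices_def)
  then have words: "set (lpa_word (\<alpha>, w, \<beta>)) \<subseteq> lpa_gens G"
    by (rule lpa_word_words)
  show ?thesis
  proof (cases \<alpha>)
    case Nil
    then show ?thesis
      using that[of "Vert w" "map Ghost (rev \<beta>)"] words assms(1) by (auto simp: awalk_Nil_iff)
  next
    case (Cons e \<alpha>')
    then show ?thesis
      using that[of "Edge e" "map Edge \<alpha>' @ Vert w # map Ghost (rev \<beta>)"] words assms(1)
      by (auto simp: awalk_Cons_iff)
  qed
qed

text \<open>Induction step of the normal form. A letter that does not end where
  \<open>\<alpha>\<close> starts gives \<open>0\<close>; a vertex is absorbed; an edge lengthens
  \<open>\<alpha>\<close>; a ghost meets the first edge of \<open>\<alpha>\<close> and cancels it or
  gives \<open>0\<close>, or it lengthens \<open>\<beta>\<close> if \<open>\<alpha>\<close> is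
  trivial.\<close>

lemma reducible_Cons_lpa_word:
  assumes x: "x \<in> lpa_gens G" and t: "t \<in> lpa_indices"
  shows "reducible (x # lpa_word t)"
proof -
  obtain \<alpha> w \<beta> v v' where t_eq: "t = (\<alpha>, w, \<beta>)" and \<alpha>: "awalk v \<alpha> w" and \<beta>: "awalk v' \<beta> w"
    using t by (auto simp: lpa_indices_def)
  obtain y z where yz: "lpa_word t = y # z" "letter_src y = v" "y \<in> lpa_gens G" "z \<in> lpa_words"
    using lpa_word_Cons[OF \<alpha> \<beta>] t_eq by metis
  note words = walk_word[OF \<alpha>] walk_word[OF \<beta>]
  show ?thesis
  proof (cases "letter_tgt x = v")
    case False
    then have "monom (x # lpa_word t) c \<approx> 0" for c
      using word_zero[of x y "[]" z c] x yz by simp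
    then show ?thesis
      by (simp add: reducible_def)
  next
    case tgt: True
    show ?thesis
    proof (cases x)
      case (Vert v0)
      then have "monom (x # lpa_word t) c \<approx> monom (lpa_word t) c" for c
        using word_src[of y "[]" z c] yz tgt by simp
      then show ?thesis
        using reducible_cong reducible_lpa_word[OF t] by blast
    next
      case (Edge e)
      then have "(e # \<alpha>, w, \<beta>) \<in> lpa_indices"
        using \<alpha> \<beta> tgt x by (auto simp: lpa_indices_def awalk_Cons_iff)
      then show ?thesis
        using reducible_lpa_word[of "(e # \<alpha>, w, \<beta>)"] Edge t_eq by simp
    next
      case (Ghost e)
      then have e: "e \<in> arcs G" "tail G e = v"
        using x tgt by auto
      show ?thesis
      proof (cases \<alpha>)
        case Nil
        then have "v = w"
          using \<alpha> by (simp add: awalk_Nil_iff)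
        let ?z = "map Ghost (rev \<beta>)"
        have z: "?z \<in> lpa_words"
          using words by simp
        \<comment> \<open>\<open>\<beta>\<close> ends at the tail of \<open>e\<close>, and
          \<open>(\<beta> e)^* = e^* \<beta>^*\<close>, so the new edge goes to the end of
          \<open>\<beta>\<close>.\<close>
        have "monom (x # lpa_word t) c \<approx> monom (lpa_word ([], head G e, \<beta> @ [e])) c" for c
        proof -
          have "monom (x # lpa_word t) c \<approx> monom (Ghost e # ?z) c"
            using word_tgt[of "Ghost e" "[]" ?z c] e z Ghost t_eq Nil \<open>v = w\<close> by simp
          also have "\<dots> \<approx> monom (Vert (head G e) # Ghost e # ?z) c"
            using word_src[of "Ghost e" "[]" ?z c] e z by - (rule lpa_cong_sym, simp)
          finally show ?thesis
            by simp
        qed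
        moreover have "awalk v' (\<beta> @ [e]) (head G e)"
          using arc_implies_awalk[OF e(1)] e(2) \<open>v = w\<close> by (intro awalk_appendI[OF \<beta>]) simp
        then have "([], head G e, \<beta> @ [e]) \<in> lpa_indices"
          using e by (auto simp: lpa_indices_def awalk_Nil_iff)
        ultimately show ?thesis
          using reducible_cong reducible_lpa_word by blast
      next
        case (Cons f \<alpha>')
        then have f: "f \<in> arcs G" "tail G f = v" and \<alpha>': "awalk (head G f) \<alpha>' w"
          using \<alpha> by (auto simp: awalk_Cons_iff)
        let ?z = "map Edge \<alpha>' @ Vert w # map Ghost (rev \<beta>)"
        have z: "?z \<in> lpa_words"
          using words Cons by auto
        have eq: "x # lpa_word t = Ghost e # Edge f # ?z"
          using Ghost t_eq Cons by simp
        show ?thesis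
        proof (cases "e = f")
          case False
          then have "monom (x # lpa_word t) c \<approx> 0" for c
            using word_ghost_edge_zero[of e f "[]" ?z c] e f z eq by simp
          then show ?thesis
            by (simp add: reducible_def)
        next
          case True
          have "monom (x # lpa_word t) c \<approx> monom (lpa_word (\<alpha>', w, \<beta>)) c" for c
          proof -
            have "monom (x # lpa_word t) c \<approx> monom (Vert (head G f) # ?z) c"
              using word_ghost_edge[of e "[]" ?z c] e z eq True by simp
            also have "\<dots> \<approx> monom ?z c"
              using word_absorb_src[OF \<alpha>', of "[]" "map Ghost (rev \<beta>)" c] words by simp
            finally show ?thesis
              by simp
          qed
          moreover have "(\<alpha>', w, \<beta>) \<in> lpa_indices"
            using \<alpha>' \<beta> by (auto simp: lpa_indices_def)
          ultimately show ?thesis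
            using reducible_cong reducible_lpa_word by blast
        qed
      qed
    qed
  qed
qed

text \<open>Base case: \<open>x\<close> equals \<open>x\<close> times its target vertex, which is a
  normal word with two trivial paths.\<close>

lemma reducible_letter:
  assumes "x \<in> lpa_gens G"
  shows "reducible [x]"
proof -
  have "([], letter_tgt x, []) \<in> lpa_indices"
    using letter_tgt_verts[OF assms] by (auto simp: lpa_indices_def awalk_Nil_iff)
  then have "reducible (x # lpa_word ([], letter_tgt x, []))"
    using reducible_Cons_lpa_word assms by blast
  moreover have "monom [x] c \<approx> monom (x # lpa_word ([], letter_tgt x, [])) c" for c
    using word_tgt[of x "[]" "[]" c] assms by - (rule lpa_cong_sym, simp)
  ultimately show ?thesis
    using reducible_cong by blast
qed

lemma reducible_word:
  assumes "x \<noteq> []" "set x \<subseteq> lpa_gens G"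
  shows "reducible x"
  using assms
proof (induction x rule: list_nonempty_induct)
  case (single x)
  then show ?case
    by (simp add: reducible_letter)
next
  case (cons x xs)
  then have x: "x \<in> lpa_gens G" and "reducible xs"
    by auto
  then consider "\<forall>c. monom xs c \<approx> 0"
    | t where "t \<in> lpa_indices" "\<forall>c. monom xs c \<approx> monom (lpa_word t) c"
    unfolding reducible_def by blast
  then show ?case
  proof cases
    case 1
    then have "monom (x # xs) c \<approx> 0" for c
      using lpa_cong_ctx_zero[of xs "[x]" "[]" c] x by simp
    then show ?thesis
      by (simp add: reducible_def)
  next
    case (2 t)
    then have "monom (x # xs) c \<approx> monom (x # lpa_word t) c" for c
      using lpa_cong_ctx_monom[of xs "lpa_word t" "[x]" "[]" c] x by simp
    then show ?thesis
      using reducible_cong reducible_Cons_lpa_word[OF x \<open>t \<in> _\<close>] by blast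
  qed
qed

lemma lpa_cong_sum: "(\<And>i. i \<in> S \<Longrightarrow> f i \<approx> g i) \<Longrightarrow> sum f S \<approx> sum g S"
  unfolding lpa_cong_def sum_subtractf[symmetric] by (rule rng_ideal_sum[OF rng_ideal_lpa_ideal])

lemma monom_sum: "(\<Sum>i\<in>S. monom w (c i)) = monom w (\<Sum>i\<in>S. c i)"
  for c :: "'i \<Rightarrow> 'c::comm_monoid_add"
  by (induction S rule: infinite_finite_induct) (simp_all add: single_add)

lemma normal_form:
  assumes f: "f \<in> carrier (free_algebra (lpa_gens G))"
  obtains S c where "finite S" "S \<subseteq> lpa_indices" "f \<approx> (\<Sum>t\<in>S. monom (lpa_word t) (c t))"
proof -
  let ?c = "\<lambda>x. Poly_Mapping.lookup f x"
  \<comment> \<open>\<open>Z\<close> consists of the words that vanish modulo the relations; the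
    words left in \<open>N\<close> reduce to normal ones.\<close>
  define Z where "Z = {x \<in> Poly_Mapping.keys f. \<forall>c. Poly_Mapping.single x c \<approx> 0}"
  define N where "N = Poly_Mapping.keys f - Z"
  have "\<exists>t\<in>lpa_indices. \<forall>c. Poly_Mapping.single x c \<approx> monom (lpa_word t) c" if "x \<in> N" for x
  proof -
    have "x \<in> Poly_Mapping.keys f"
      using that by (simp add: N_def)
    then have "x \<noteq> 0" "set (letters x) \<subseteq> lpa_gens G"
      using f unfolding in_carrier_free_algebra by blast+
    moreover from this have "letters x \<noteq> []"
      by (cases x) (simp add: zero_free_monoid_def)
    ultimately have "reducible (letters x)"
      by (intro reducible_word)
    moreover have "\<not> (\<forall>c. Poly_Mapping.single x c \<approx> 0)"
      using that by (simp add: N_def Z_def)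
    ultimately show ?thesis
      by (simp add: reducible_def)
  qed
  then obtain t where t: "\<And>x. x \<in> N \<Longrightarrow> t x \<in> lpa_indices"
      "\<And>x c. x \<in> N \<Longrightarrow> Poly_Mapping.single x c \<approx> monom (lpa_word (t x)) c"
    by metis
  have fin: "finite N" "finite Z"
    by (auto simp: N_def Z_def)
  have "f = (\<Sum>x\<in>Poly_Mapping.keys f. Poly_Mapping.single x (?c x))"
    by (rule poly_mapping_sum_monoms)
  also have "\<dots> \<approx> (\<Sum>x\<in>Poly_Mapping.keys f. if x \<in> N then monom (lpa_word (t x)) (?c x) else 0)"
    by (rule lpa_cong_sum) (use t(2) in \<open>auto simp: N_def Z_def\<close>)
  also have "\<dots> = (\<Sum>x\<in>N. monom (lpa_word (t x)) (?c x))"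
    by (rule sum.mono_neutral_cong_right) (auto simp: N_def)
  \<comment> \<open>Different words may reduce to the same index, so coefficients are collected over
    the fibres of \<open>t\<close>.\<close>
  also have "\<dots> = (\<Sum>s\<in>t ` N. \<Sum>x\<in>{x \<in> N. t x = s}. monom (lpa_word (t x)) (?c x))"
    by (rule sum.image_gen) (rule fin)
  also have "\<dots> = (\<Sum>s\<in>t ` N. monom (lpa_word s) (\<Sum>x\<in>{x \<in> N. t x = s}. ?c x))"
    unfolding monom_sum[symmetric] by (intro sum.cong) auto
  finally have "f \<approx> (\<Sum>s\<in>t ` N. monom (lpa_word s) (\<Sum>x\<in>{x \<in> N. t x = s}. ?c x))" .
  then show ?thesis
    using that[of "t ` N" "\<lambda>s. \<Sum>x\<in>{x \<in> N. t x = s}. ?c x"] fin t(1) by blast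
qed

section \<open>Isolating one term of a normal form\<close>

text \<open>This and \<open>sandwich_right\<close> encode \<open>u^* \<alpha>^*\<close> and
  \<open>\<beta> u\<close>, with vertex letters that mark the ends of the paths and keep the words
  nonempty.\<close>

definition sandwich_left :: "'b list \<Rightarrow> 'a \<Rightarrow> 'b list \<Rightarrow> 'a \<Rightarrow> ('a, 'b) lpa_gen list" where
  "sandwich_left \<alpha> w u p = Vert p # map Ghost (rev u) @ Vert w # map Ghost (rev \<alpha>)"

definition sandwich_right :: "'b list \<Rightarrow> 'a \<Rightarrow> 'b list \<Rightarrow> 'a \<Rightarrow> ('a, 'b) lpa_gen list" where
  "sandwich_right \<beta> w u p = map Edge \<beta> @ Vert w # map Edge u @ [Vert p]"

text \<open>\<open>\<alpha>^* \<alpha>\<close>, \<open>\<beta>^* \<beta>\<close> and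
  \<open>u^* u\<close> collapse one after another.\<close>

lemma sandwich_same:
  assumes \<alpha>: "awalk v \<alpha> w" and \<beta>: "awalk v' \<beta> w" and u: "awalk w u p"
  shows "monom (sandwich_left \<alpha> w u p @ lpa_word (\<alpha>, w, \<beta>) @ sandwich_right \<beta> w u p) c \<approx>
    monom [Vert p] c"
proof -
  note words = walk_word[OF \<alpha>] walk_word[OF \<beta>] walk_word[OF u]
  let ?u = "Vert p # map Ghost (rev u)" and ?z = "map Edge u @ [Vert p]"
  have uz: "?u \<in> lpa_words" "?z \<in> lpa_words"
    using words by auto
  have "monom (?u @ Vert w # map Ghost (rev \<alpha>) @ map Edge \<alpha> @
      Vert w # map Ghost (rev \<beta>) @ map Edge \<beta> @ Vert w # ?z) c \<approx>
    monom (?u @ Vert w # map Ghost (rev \<beta>) @ map Edge \<beta> @ Vert w # ?z) c"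
    using words uz by (intro word_ghost_walk_walk[OF \<alpha>]) auto
  also have "\<dots> \<approx> monom (?u @ Vert w # ?z) c"
    by (intro word_ghost_walk_walk[OF \<beta>] uz)
  also have "\<dots> \<approx> monom (?u @ ?z) c"
    using word_absorb_src[OF u uz(1), of "[]" c] by simp
  also have "\<dots> \<approx> monom [Vert p] c"
    using word_ghost_walk_walk[OF u, of "[]" "[]" c] by simp
  finally show ?thesis
    by (simp add: sandwich_left_def sandwich_right_def)
qed

text \<open>\<open>\<beta>2^* \<beta>\<close> survives only if the paths are comparable, so by
  length \<open>\<beta>2 = \<beta> \<rho>\<close>. For trivial \<open>\<rho>\<close>, comparable
  \<open>\<alpha>\<close> and \<open>\<alpha>2\<close> would differ by a closed walk and hence
  coincide. Otherwise \<open>\<rho>^* u = 0\<close> by the choice of \<open>u\<close>.\<close>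

lemma sandwich_other:
  assumes \<alpha>: "awalk v \<alpha> w" and \<beta>: "awalk v' \<beta> w" and u: "awalk w u p"
    and \<alpha>2: "awalk v2 \<alpha>2 w2" and \<beta>2: "awalk v2' \<beta>2 w2"
    and ne: "(\<alpha>2, w2, \<beta>2) \<noteq> (\<alpha>, w, \<beta>)"
    and len: "length \<beta> \<le> length \<beta>2"
    and acyclic: "\<And>\<rho>. awalk w \<rho> w \<Longrightarrow> \<rho> = []"
    and fresh: "\<And>\<rho>. \<lbrakk>\<beta>2 = \<beta> @ \<rho>; \<rho> \<noteq> []; awalk w \<rho> w2\<rbrakk> \<Longrightarrow> \<not> prefix u \<rho> \<and> \<not> prefix \<rho> u"
  shows "monom (sandwich_left \<alpha> w u p @ lpa_word (\<alpha>2, w2, \<beta>2) @ sandwich_right \<beta> w u p) c \<approx> 0"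
proof -
  note words = walk_word[OF \<alpha>] walk_word[OF \<beta>] walk_word[OF u] walk_word[OF \<alpha>2] walk_word[OF \<beta>2]
  let ?L = "Vert p # map Ghost (rev u)" and ?R = "map Edge u @ [Vert p]"
  let ?W = "?L @ Vert w # map Ghost (rev \<alpha>) @ map Edge \<alpha>2 @
      Vert w2 # map Ghost (rev \<beta>2) @ map Edge \<beta> @ Vert w # ?R"
  have LR: "?L \<in> lpa_words" "?R \<in> lpa_words"
    using words by auto
  let ?L' = "?L @ Vert w # map Ghost (rev \<alpha>) @ map Edge \<alpha>2"
  have L': "?L' \<in> lpa_words"
    using words by auto
  have "monom ?W c \<approx> 0"
  proof (cases "v2' = v' \<and> (prefix \<beta>2 \<beta> \<or> prefix \<beta> \<beta>2)")
    case False
    then show ?thesis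
      using word_ghost_walk_walk_zero[OF \<beta>2 \<beta> _ L' LR(2), of c] by simp
  next
    case True
    show ?thesis
    proof (cases "\<beta>2 = \<beta>")
      case eq: True
      then have w: "w2 = w"
        using awalk_ends[OF \<beta> \<beta>2[unfolded eq]] True by auto
      have "\<not> (v = v2 \<and> (prefix \<alpha> \<alpha>2 \<or> prefix \<alpha>2 \<alpha>))"
      proof
        assume *: "v = v2 \<and> (prefix \<alpha> \<alpha>2 \<or> prefix \<alpha>2 \<alpha>)"
        then obtain \<rho> where "\<alpha>2 = \<alpha> @ \<rho> \<or> \<alpha> = \<alpha>2 @ \<rho>"
          by (auto simp: prefix_def)
        then show False
        proof (elim disjE)
          assume "\<alpha>2 = \<alpha> @ \<rho>"
          then show False
            using awalk_append_right[OF \<alpha>, of \<rho> w] \<alpha>2 * ne eq w acyclic[of \<rho>] by simp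
        next
          assume "\<alpha> = \<alpha>2 @ \<rho>"
          then show False
            using awalk_append_right[OF \<alpha>2, of \<rho> w] \<alpha> * ne eq w acyclic[of \<rho>] by simp
        qed
      qed
      then show ?thesis
        using word_ghost_walk_walk_zero[OF \<alpha> \<alpha>2, of ?L
          "map Ghost (rev \<beta>2) @ map Edge \<beta> @ Vert w # ?R" c] words LR w by simp
    next
      case False
      then obtain \<rho> where \<rho>: "\<beta>2 = \<beta> @ \<rho>" "\<rho> \<noteq> []"
        using True len by (auto simp: prefix_def)
      have "awalk w \<rho> w2"
        using awalk_append_right[OF \<beta>] \<beta>2 \<rho> True by simp
      then have "\<not> prefix u \<rho>" "\<not> prefix \<rho> u"
        using fresh \<rho> by auto
      then have inc: "\<not> (v2' = v' \<and> (prefix \<beta>2 (\<beta> @ u) \<or> prefix (\<beta> @ u) \<beta>2))"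
        using \<rho> by simp
      have \<beta>u: "awalk v' (\<beta> @ u) p"
        using awalk_appendI[OF \<beta> u] .
      \<comment> \<open>Absorbing \<open>Vert w\<close> joins \<open>\<beta>\<close> and
        \<open>u\<close> into one walk, which is incomparable with \<open>\<beta>2\<close>.\<close>
      have "monom ?W c \<approx> monom (?L' @ Vert w2 # map Ghost (rev \<beta>2) @ map Edge (\<beta> @ u) @ [Vert p]) c"
        using word_absorb_src[OF u, of "?L' @ Vert w2 # map Ghost (rev \<beta>2) @ map Edge \<beta>" "[]" c] words
        by simp
      also have "\<dots> \<approx> 0"
        using word_ghost_walk_walk_zero[OF \<beta>2 \<beta>u inc L', of "[]" c] by simp
      finally show ?thesis .
    qed
  qed
  then show ?thesis
    by (simp add: sandwich_left_def sandwich_right_def)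
qed

lemma lpa_word_in_ideal:
  fixes c :: 'k
  assumes I: "rng_ideal I (free_algebra (lpa_gens G))" "lpa_ideal G \<subseteq> I"
    and w: "monom [Vert w] 1 \<in> I" and t: "(\<alpha>, w, \<beta>) \<in> lpa_indices"
  shows "monom (lpa_word (\<alpha>, w, \<beta>)) c \<in> I"
proof -
  have words: "map Edge \<alpha> \<in> lpa_words" "map Ghost (rev \<beta>) \<in> lpa_words" "w \<in> verts G"
    using lpa_word_words[OF t] by auto
  \<comment> \<open>Three copies of \<open>w\<close>: the middle one is the element of
    \<open>I\<close>, the outer ones make both multipliers nonempty words.\<close>
  let ?x = "map Edge \<alpha> @ Vert w # Vert w # Vert w # map Ghost (rev \<beta>)"
  have "?x = (map Edge \<alpha> @ [Vert w]) @ [Vert w] @ (Vert w # map Ghost (rev \<beta>))"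
    by simp
  then have "monom ?x c =
      monom (map Edge \<alpha> @ [Vert w]) c * monom [Vert w] 1 * monom (Vert w # map Ghost (rev \<beta>)) 1"
    by (simp add: monom_mult)
  also have "\<dots> \<in> I"
    using I(1) w words by (simp add: rng_ideal_free_algebra_iff monom_in_free_algebra)
  finally have x: "monom ?x c \<in> I" .
  have "monom ?x c \<approx> monom (map Edge \<alpha> @ Vert w # Vert w # map Ghost (rev \<beta>)) c"
    using word_src[of "Vert w" "map Edge \<alpha>" "Vert w # map Ghost (rev \<beta>)" c] words by simp
  also have "\<dots> \<approx> monom (lpa_word (\<alpha>, w, \<beta>)) c"
    using word_src[of "Vert w" "map Edge \<alpha>" "map Ghost (rev \<beta>)" c] words by simp
  finally have "monom ?x c - monom (lpa_word (\<alpha>, w, \<beta>)) c \<in> I"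
    using I(2) by (auto simp: lpa_cong_def)
  then have "monom ?x c - (monom ?x c - monom (lpa_word (\<alpha>, w, \<beta>)) c) \<in> I"
    using I(1) x unfolding rng_ideal_free_algebra_iff by blast
  then show ?thesis
    by simp
qed

text \<open>The central computation, for any acyclic graph. \<open>exits\<close> supplies the path
  \<open>u\<close> to \<open>p\<close>: it must avoid the finitely many paths by which other terms
  could continue \<open>\<beta>\<close>, where only terms with middle vertex outside
  \<open>I\<close> count.\<close>

lemma corner:
  assumes I: "rng_ideal I (free_algebra (lpa_gens G))" "lpa_ideal G \<subseteq> I"
    and f: "f \<in> carrier (free_algebra (lpa_gens G))" "f \<notin> I"
    and acyclic: "\<And>w \<rho>. awalk w \<rho> w \<Longrightarrow> \<rho> = []"
    and exits: "\<And>w T. \<lbrakk>w \<in> verts G; monom [Vert w] 1 \<notin> I; finite T\<rbrakk> \<Longrightarrow>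
      \<exists>u. awalk w u p \<and> (\<forall>\<rho>\<in>T. \<forall>w'. \<rho> \<noteq> [] \<longrightarrow> awalk w \<rho> w' \<longrightarrow> monom [Vert w'] 1 \<notin> I \<longrightarrow>
        \<not> prefix u \<rho> \<and> \<not> prefix \<rho> u)"
  shows "\<exists>a\<in>carrier (free_algebra (lpa_gens G)). \<exists>b\<in>carrier (free_algebra (lpa_gens G)).
    a * f * b - (monom [Vert p] 1 :: _ \<Rightarrow>\<^sub>0 'k) \<in> I"
proof -
  note add = rng_ideal_free_algebraD(2)[OF I(1)] and mult = rng_ideal_free_algebraD(4,5)[OF I(1)]
  obtain S c where S: "finite S" "S \<subseteq> lpa_indices" "f \<approx> (\<Sum>t\<in>S. monom (lpa_word t) (c t))"
    using normal_form[OF f(1)] by blast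
  let ?m = "\<lambda>t. monom (lpa_word t) (c t)"
  \<comment> \<open>The terms left out have coefficient \<open>0\<close> or a middle vertex in
    \<open>I\<close>, so they vanish modulo \<open>I\<close>.\<close>
  define S' where "S' = {(\<alpha>, w, \<beta>) \<in> S. c (\<alpha>, w, \<beta>) \<noteq> 0 \<and> (monom [Vert w] 1 :: _ \<Rightarrow>\<^sub>0 'k) \<notin> I}"
  have S': "finite S'" "S' \<subseteq> S" "S' \<subseteq> lpa_indices"
    using S by (auto simp: S'_def intro: finite_subset)
  have "?m t \<in> I" if t: "t \<in> S - S'" for t
  proof (cases "c t = 0")
    case True
    then show ?thesis
      using I(1) by (simp add: rng_ideal_free_algebra_iff)
  next
    case False
    obtain \<alpha> w \<beta> where t_eq: "t = (\<alpha>, w, \<beta>)"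
      by (cases t)
    then have "monom [Vert w] 1 \<in> I"
      using False t by (auto simp: S'_def)
    then show ?thesis
      using lpa_word_in_ideal[OF I] t S(2) unfolding t_eq by blast
  qed
  then have "(\<Sum>t\<in>S - S'. ?m t) \<in> I"
    by (rule rng_ideal_sum[OF I(1)])
  moreover have "f - (\<Sum>t\<in>S. ?m t) \<in> I"
    using S(3) I(2) by (auto simp: lpa_cong_def)
  ultimately have "(f - (\<Sum>t\<in>S. ?m t)) + (\<Sum>t\<in>S - S'. ?m t) \<in> I"
    by (intro add)
  moreover have "(\<Sum>t\<in>S. ?m t) = (\<Sum>t\<in>S - S'. ?m t) + (\<Sum>t\<in>S'. ?m t)"
    using S(1) S'(2) by (rule sum.subset_diff[rotated])
  ultimately have fI: "f - (\<Sum>t\<in>S'. ?m t) \<in> I"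
    by (simp add: algebra_simps)
  then have "S' \<noteq> {}"
    using f(2) by auto
  \<comment> \<open>A term with \<open>\<beta>\<close> of minimal length, as the length condition of
    \<open>sandwich_other\<close> requires.\<close>
  then obtain t0 where "is_arg_min (\<lambda>t. length (snd (snd t))) (\<lambda>t. t \<in> S') t0"
    using ex_is_arg_min_if_finite[OF S'(1)] by blast
  then have t0: "t0 \<in> S'" "\<And>t. t \<in> S' \<Longrightarrow> length (snd (snd t0)) \<le> length (snd (snd t))"
    by (auto simp: is_arg_min_linorder)
  obtain \<alpha> w \<beta> where t0_eq: "t0 = (\<alpha>, w, \<beta>)"
    by (cases t0)
  obtain v v' where \<alpha>: "awalk v \<alpha> w" and \<beta>: "awalk v' \<beta> w"
    using t0(1) S'(3) t0_eq by (auto simp: lpa_indices_def)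
  have c0: "c t0 \<noteq> 0" and w: "monom [Vert w] 1 \<notin> I"
    using t0(1) by (auto simp: S'_def t0_eq)
  \<comment> \<open>If \<open>\<beta>2 = \<beta> \<rho>\<close>, dropping
    \<open>length \<beta>\<close> edges from \<open>\<beta>2\<close> yields exactly
    \<open>\<rho>\<close>; so \<open>T\<close> contains all continuations to be avoided.\<close>
  define T where "T = (\<lambda>t. drop (length \<beta>) (snd (snd t))) ` S'"
  have "finite T"
    using S'(1) by (simp add: T_def)
  from exits[OF awalk_last_in_verts[OF \<alpha>] w this] obtain u where u: "awalk w u p"
    and fresh: "\<forall>\<rho>\<in>T. \<forall>w'. \<rho> \<noteq> [] \<longrightarrow> awalk w \<rho> w' \<longrightarrow> monom [Vert w'] 1 \<notin> I \<longrightarrow>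
      \<not> prefix u \<rho> \<and> \<not> prefix \<rho> u"
    by (elim exE conjE)
  \<comment> \<open>The inverse coefficient normalises the surviving term to \<open>p\<close>
    itself.\<close>
  define a where "a = monom (sandwich_left \<alpha> w u p) (inverse (c t0))"
  define b where "b = (monom (sandwich_right \<beta> w u p) 1 :: _ \<Rightarrow>\<^sub>0 'k)"
  have ab: "a \<in> carrier (free_algebra (lpa_gens G))" "b \<in> carrier (free_algebra (lpa_gens G))"
    using walk_word[OF \<alpha>] walk_word[OF \<beta>] walk_word[OF u]
    unfolding a_def b_def sandwich_left_def sandwich_right_def
    by (simp_all add: monom_in_free_algebra)
  have "a * ?m t * b \<approx> (if t = t0 then monom [Vert p] 1 else 0)" if t: "t \<in> S'" for t
  proof -
    have eq: "a * ?m t * b =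
        monom (sandwich_left \<alpha> w u p @ lpa_word t @ sandwich_right \<beta> w u p) (inverse (c t0) * c t)"
      by (simp add: a_def b_def monom_mult)
    show ?thesis
    proof (cases "t = t0")
      case True
      then show ?thesis
        using sandwich_same[OF \<alpha> \<beta> u, of 1] c0 unfolding eq by (simp add: t0_eq)
    next
      case False
      obtain \<alpha>2 w2 \<beta>2 where t_eq: "t = (\<alpha>2, w2, \<beta>2)"
        by (cases t)
      obtain v2 v2' where \<alpha>2: "awalk v2 \<alpha>2 w2" and \<beta>2: "awalk v2' \<beta>2 w2"
        using t S'(3) t_eq by (auto simp: lpa_indices_def)
      have "length \<beta> \<le> length \<beta>2"
        using t0(2)[OF t] by (simp add: t_eq t0_eq)
      moreover have "(\<alpha>2, w2, \<beta>2) \<noteq> (\<alpha>, w, \<beta>)"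
        using False by (simp add: t_eq t0_eq)
      moreover have "\<not> prefix u \<rho> \<and> \<not> prefix \<rho> u"
        if "\<beta>2 = \<beta> @ \<rho>" "\<rho> \<noteq> []" "awalk w \<rho> w2" for \<rho>
      proof -
        have "\<rho> \<in> T"
          using t that(1) unfolding T_def by (intro image_eqI[where x = t]) (simp_all add: t_eq)
        moreover have "monom [Vert w2] 1 \<notin> I"
          using t by (simp add: S'_def t_eq)
        ultimately show ?thesis
          using fresh that(2,3) by blast
      qed
      ultimately have "monom (sandwich_left \<alpha> w u p @ lpa_word (\<alpha>2, w2, \<beta>2) @ sandwich_right \<beta> w u p)
          (inverse (c t0) * c t) \<approx> 0"
        using acyclic by (intro sandwich_other[OF \<alpha> \<beta> u \<alpha>2 \<beta>2])
      then show ?thesis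
        using False unfolding eq by (simp add: t_eq)
    qed
  qed
  then have terms: "(\<Sum>t\<in>S'. a * ?m t * b) \<approx> (\<Sum>t\<in>S'. if t = t0 then monom [Vert p] 1 else 0)"
    by (rule lpa_cong_sum)
  have sum_a: "(\<Sum>t\<in>S'. a * ?m t * b) = a * (\<Sum>t\<in>S'. ?m t) * b"
    by (simp only: sum_distrib_left sum_distrib_right)
  have sum_p: "(\<Sum>t\<in>S'. if t = t0 then monom [Vert p] 1 else 0) =
      (monom [Vert p] 1 :: ('a, 'b) lpa_gen free_monoid \<Rightarrow>\<^sub>0 'k)"
    using t0(1) S'(1) by simp
  from terms have "a * (\<Sum>t\<in>S'. ?m t) * b \<approx> monom [Vert p] 1"
    unfolding sum_a sum_p .
  then have 1: "a * (\<Sum>t\<in>S'. ?m t) * b - monom [Vert p] 1 \<in> I"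
    using I(2) by (auto simp: lpa_cong_def)
  have "a * (f - (\<Sum>t\<in>S'. ?m t)) * b \<in> I"
    using fI ab by (intro mult)
  from add[OF this 1] have "a * f * b - monom [Vert p] 1 \<in> I"
    by (simp add: algebra_simps)
  then show ?thesis
    using ab by blast
qed

section \<open>Vertices outside an ideal\<close>

lemma lpa_word_snoc:
  assumes "awalk v \<alpha> w" "awalk v' \<beta> w"
  obtains y z where "lpa_word (\<alpha>, w, \<beta>) = z @ [y]" "letter_tgt y = v'" "y \<in> lpa_gens G" "z \<in> lpa_words"
proof -
  have "(\<alpha>, w, \<beta>) \<in> lpa_indices"
    using assms by (auto simp: lpa_indices_def)
  then have words: "set (lpa_word (\<alpha>, w, \<beta>)) \<subseteq> lpa_gens G"
    by (rule lpa_word_words)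
  show ?thesis
  proof (cases \<beta>)
    case Nil
    then show ?thesis
      using that[of "map Edge \<alpha>" "Vert w"] words assms(2) by (auto simp: awalk_Nil_iff)
  next
    case (Cons e \<beta>')
    then show ?thesis
      using that[of "map Edge \<alpha> @ Vert w # map Ghost (rev \<beta>')" "Ghost e"] words assms(2)
      by (auto simp: awalk_Cons_iff)
  qed
qed

text \<open>Multiplying by vertices on both sides selects terms by their ends: the outer letters of
  a normal word carry the starts of \<open>\<alpha>\<close> and \<open>\<beta>\<close>.\<close>

lemma vert_lpa_word_vert_zero:
  assumes \<alpha>: "awalk v \<alpha> w" and \<beta>: "awalk v' \<beta> w" and pq: "p \<in> verts G" "q \<in> verts G" "v \<noteq> p \<or> v' \<noteq> q"
  shows "monom (Vert p # lpa_word (\<alpha>, w, \<beta>) @ [Vert q]) c \<approx> 0"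
proof (cases "v = p")
  case False
  obtain y z where yz: "lpa_word (\<alpha>, w, \<beta>) = y # z" "letter_src y = v" "y \<in> lpa_gens G" "z \<in> lpa_words"
    using lpa_word_Cons[OF \<alpha> \<beta>] .
  then show ?thesis
    using word_zero[of "Vert p" y "[]" "z @ [Vert q]" c] pq False by simp
next
  case True
  obtain y z where yz: "lpa_word (\<alpha>, w, \<beta>) = z @ [y]" "letter_tgt y = v'" "y \<in> lpa_gens G" "z \<in> lpa_words"
    using lpa_word_snoc[OF \<alpha> \<beta>] .
  then show ?thesis
    using word_zero[of y "Vert q" "Vert p # z" "[]" c] pq True by simp
qed

text \<open>Every normal term has its middle vertex as a factor. Hence a proper ideal misses some
  vertex.\<close>

lemma ideal_all_verts:
  assumes I: "rng_ideal I (free_algebra (lpa_gens G))" "lpa_ideal G \<subseteq> I"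
    and verts: "\<And>v. v \<in> verts G \<Longrightarrow> (gen (Vert v) :: _ \<Rightarrow>\<^sub>0 'k) \<in> I"
  shows "I = carrier (free_algebra (lpa_gens G))"
proof
  show "I \<subseteq> carrier (free_algebra (lpa_gens G))"
    using I(1) by (simp add: rng_ideal_free_algebra_iff)
  show "carrier (free_algebra (lpa_gens G)) \<subseteq> I"
  proof
    fix f :: "('a, 'b) lpa_gen free_monoid \<Rightarrow>\<^sub>0 'k"
    assume f: "f \<in> carrier (free_algebra (lpa_gens G))"
    obtain S c where S: "S \<subseteq> lpa_indices" "f \<approx> (\<Sum>t\<in>S. monom (lpa_word t) (c t))"
      using normal_form[OF f] by blast
    have "monom (lpa_word t) (c t) \<in> I" if "t \<in> S" for t
    proof -
      obtain \<alpha> w \<beta> where t: "t = (\<alpha>, w, \<beta>)"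
        by (cases t)
      then have tI: "(\<alpha>, w, \<beta>) \<in> lpa_indices"
        using that S(1) by blast
      then have "w \<in> verts G"
        using lpa_word_words[OF tI] by simp
      then have "monom [Vert w] 1 \<in> I"
        using verts[of w] by (simp add: gen_def)
      then show ?thesis
        using lpa_word_in_ideal[OF I _ tI] unfolding t by blast
    qed
    then have "(\<Sum>t\<in>S. monom (lpa_word t) (c t)) \<in> I"
      by (rule rng_ideal_sum[OF I(1)])
    moreover have "f - (\<Sum>t\<in>S. monom (lpa_word t) (c t)) \<in> I"
      using S(2) I(2) by (auto simp: lpa_cong_def)
    ultimately have "(f - (\<Sum>t\<in>S. monom (lpa_word t) (c t))) + (\<Sum>t\<in>S. monom (lpa_word t) (c t)) \<in> I"
      by (intro rng_ideal_free_algebraD(2)[OF I(1)])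
    then show "f \<in> I"
      by simp
  qed
qed

text \<open>If no common \<open>w\<close> existed, each normal term multiplied by \<open>p\<close>
  and \<open>q\<close> would vanish or have its middle vertex in \<open>I\<close>; so
  \<open>p f q\<close> would lie in \<open>I\<close> for all \<open>f\<close>, against
  primeness.\<close>

lemma prime_ideal_verts_directed:
  assumes I: "rng_prime_ideal I (free_algebra (lpa_gens G))" "lpa_ideal G \<subseteq> I"
    and p: "p \<in> verts G" "(gen (Vert p) :: _ \<Rightarrow>\<^sub>0 'k) \<notin> I"
    and q: "q \<in> verts G" "(gen (Vert q) :: _ \<Rightarrow>\<^sub>0 'k) \<notin> I"
  shows "\<exists>w \<alpha> \<beta>. (gen (Vert w) :: _ \<Rightarrow>\<^sub>0 'k) \<notin> I \<and> awalk p \<alpha> w \<and> awalk q \<beta> w"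
proof (rule ccontr)
  assume contr: "\<not> ?thesis"
  let ?A = "free_algebra (lpa_gens G) :: ('k, ('a, 'b) lpa_gen free_monoid \<Rightarrow>\<^sub>0 'k) module"
  have ideal: "rng_ideal I ?A"
    using I(1) by (simp add: rng_prime_ideal_def)
  note D = rng_ideal_free_algebraD[OF ideal]
  let ?p = "gen (Vert p) :: ('a, 'b) lpa_gen free_monoid \<Rightarrow>\<^sub>0 'k"
  let ?q = "gen (Vert q) :: ('a, 'b) lpa_gen free_monoid \<Rightarrow>\<^sub>0 'k"
  have pq: "?p \<in> carrier ?A" "?q \<in> carrier ?A"
    using p q by (simp_all add: gen_def monom_in_free_algebra)
  have "?p * f * ?q \<in> I" if f: "f \<in> carrier ?A" for f
  proof -
    obtain S c where S: "S \<subseteq> lpa_indices" "f \<approx> (\<Sum>t\<in>S. monom (lpa_word t) (c t))"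
      using normal_form[OF f] by blast
    have "?p * monom (lpa_word t) (c t) * ?q \<in> I" if t: "t \<in> S" for t
    proof -
      obtain \<alpha> w \<beta> where t_eq: "t = (\<alpha>, w, \<beta>)"
        by (cases t)
      then have tI: "(\<alpha>, w, \<beta>) \<in> lpa_indices"
        using t S(1) by blast
      then obtain v v' where \<alpha>: "awalk v \<alpha> w" and \<beta>: "awalk v' \<beta> w"
        by (auto simp: lpa_indices_def)
      show ?thesis
      proof (cases "v = p \<and> v' = q")
        case True
        then have "gen (Vert w) \<in> I"
          using contr \<alpha> \<beta> by blast
        then have "monom (lpa_word t) (c t) \<in> I"
          using lpa_word_in_ideal[OF ideal I(2) _ tI] unfolding t_eq gen_def by blast
        then show ?thesis
          using pq by (rule D(5)[OF D(4)])
      next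
        case False
        then have "monom (Vert p # lpa_word t @ [Vert q]) (c t) \<approx> 0"
          using vert_lpa_word_vert_zero[OF \<alpha> \<beta> p(1) q(1)] unfolding t_eq by blast
        moreover have "monom (Vert p # lpa_word t @ [Vert q]) (c t) = ?p * monom (lpa_word t) (c t) * ?q"
          by (simp add: gen_def monom_mult)
        ultimately show ?thesis
          using I(2) by (auto simp: lpa_cong_def)
      qed
    qed
    then have "(\<Sum>t\<in>S. ?p * monom (lpa_word t) (c t) * ?q) \<in> I"
      by (rule rng_ideal_sum[OF ideal])
    then have 1: "?p * (\<Sum>t\<in>S. monom (lpa_word t) (c t)) * ?q \<in> I"
      by (simp only: sum_distrib_left sum_distrib_right)
    have "f - (\<Sum>t\<in>S. monom (lpa_word t) (c t)) \<in> I"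
      using S(2) I(2) by (auto simp: lpa_cong_def)
    then have "?p * (f - (\<Sum>t\<in>S. monom (lpa_word t) (c t))) * ?q \<in> I"
      using pq by (rule D(5)[OF D(4)])
    from D(2)[OF this 1] show ?thesis
      by (simp add: algebra_simps)
  qed
  then have "{?p \<otimes>\<^bsub>?A\<^esub> r \<otimes>\<^bsub>?A\<^esub> ?q |r. r \<in> carrier ?A} \<subseteq> I"
    unfolding free_algebra_simps by blast
  then have "?p \<in> I \<or> ?q \<in> I"
    using I(1) pq unfolding rng_prime_ideal_def by blast
  then show False
    using p q by blast
qed

end

section \<open>Monomial representations\<close>

text \<open>A word acts as a composite of partial maps, its last letter first; \<open>None\<close>
  stands for the zero vector.\<close>

fun word_act :: "('x \<Rightarrow> 's \<Rightarrow> 's option) \<Rightarrow> 'x list \<Rightarrow> 's \<Rightarrow> 's option" where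
  "word_act act [] s = Some s"
| "word_act act (x # xs) s = Option.bind (word_act act xs s) (act x)"

lemma word_act_append: "word_act act (u @ w) s = Option.bind (word_act act w s) (word_act act u)"
  by (induction u; cases "word_act act w s") simp_all

text \<open>The operator pulls functions back along the partial map, extended by \<open>0\<close>.
  It acts on arbitrary functions \<open>h\<close>, at the cost that products reverse their order, as
  in \<open>word_op_plus\<close>.\<close>

definition word_op :: "('x \<Rightarrow> 's \<Rightarrow> 's option) \<Rightarrow> 'x free_monoid \<Rightarrow> ('s \<Rightarrow> 'k::field) \<Rightarrow> 's \<Rightarrow> 'k" where
  "word_op act w h s = (case word_act act (letters w) s of None \<Rightarrow> 0 | Some t \<Rightarrow> h t)"

lemma word_op_plus: "word_op act (u + w) h = word_op act w (word_op act u h)"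
  by (auto simp: word_op_def plus_free_monoid_def word_act_append fun_eq_iff split: option.split)

lemma word_op_sum: "word_op act w (\<lambda>s. \<Sum>i\<in>A. c i * h i s) s = (\<Sum>i\<in>A. c i * word_op act w (h i) s)"
  by (simp add: word_op_def split: option.split)

definition act_op ::
    "('x \<Rightarrow> 's \<Rightarrow> 's option) \<Rightarrow> ('x free_monoid \<Rightarrow>\<^sub>0 'k::field) \<Rightarrow> ('s \<Rightarrow> 'k) \<Rightarrow> 's \<Rightarrow> 'k" where
  "act_op act f h s = (\<Sum>w\<in>Poly_Mapping.keys f. Poly_Mapping.lookup f w * word_op act w h s)"

text \<open>Puts sums over different supports on one common index set.\<close>

lemma act_op_superset:
  "\<lbrakk>finite A; Poly_Mapping.keys f \<subseteq> A\<rbrakk> \<Longrightarrow>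
    act_op act f h s = (\<Sum>w\<in>A. Poly_Mapping.lookup f w * word_op act w h s)"
  unfolding act_op_def by (rule sum.mono_neutral_left) (auto simp: in_keys_iff)

lemma act_op_add: "act_op act (f + g) h s = act_op act f h s + act_op act g h s"
proof -
  let ?A = "Poly_Mapping.keys f \<union> Poly_Mapping.keys g"
  have "Poly_Mapping.keys (f + g) \<subseteq> ?A"
    by (rule Poly_Mapping.keys_add)
  then show ?thesis
    using act_op_superset[of ?A "f + g" act h s] act_op_superset[of ?A f act h s] act_op_superset[of ?A g act h s]
    by (simp add: lookup_add algebra_simps sum.distrib)
qed

lemma act_op_uminus: "act_op act (- f) h s = - act_op act f h s"
  using act_op_superset[of "Poly_Mapping.keys f" "- f" act h s]
  by (simp add: act_op_def in_keys_iff subset_iff sum_negf)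

lemma act_op_minus: "act_op act (f - g) h s = act_op act f h s - act_op act g h s"
  using act_op_add[of act f "- g" h s] by (simp add: act_op_uminus)

lemma act_op_zero: "act_op act 0 h s = 0"
  by (simp add: act_op_def)

lemma act_op_single: "act_op act (Poly_Mapping.single w c) h s = c * word_op act w h s"
  by (simp add: act_op_def)

lemma act_op_sum: "act_op act (sum f A) h s = (\<Sum>i\<in>A. act_op act (f i) h s)"
  by (induction A rule: infinite_finite_induct) (simp_all add: act_op_zero act_op_add)

lemma act_op_mult: "act_op act (f * g) h s = act_op act g (act_op act f h) s"
proof -
  let ?F = "Poly_Mapping.lookup f" and ?G = "Poly_Mapping.lookup g"
  have "f * g = (\<Sum>u\<in>Poly_Mapping.keys f. Poly_Mapping.single u (?F u)) *
      (\<Sum>w\<in>Poly_Mapping.keys g. Poly_Mapping.single w (?G w))"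
    using poly_mapping_sum_monoms[of f] poly_mapping_sum_monoms[of g] by simp
  also have "\<dots> = (\<Sum>w\<in>Poly_Mapping.keys g. \<Sum>u\<in>Poly_Mapping.keys f. Poly_Mapping.single (u + w) (?F u * ?G w))"
    by (simp add: sum_product mult_single) (rule sum.swap)
  finally have "act_op act (f * g) h s =
      (\<Sum>w\<in>Poly_Mapping.keys g. ?G w * (\<Sum>u\<in>Poly_Mapping.keys f. ?F u * word_op act w (word_op act u h) s))"
    by (simp add: act_op_sum act_op_single word_op_plus sum_distrib_left mult_ac)
  also have "\<dots> = act_op act g (act_op act f h) s"
    unfolding act_op_def[abs_def] by (simp add: word_op_sum)
  finally show ?thesis .
qed

lemma act_op_zero_right: "act_op act f (\<lambda>_. 0) s = 0"
  unfolding act_op_def word_op_def by (rule sum.neutral) (simp split: option.split)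

definition act_kernel ::
    "('x \<Rightarrow> 's \<Rightarrow> 's option) \<Rightarrow> 'x set \<Rightarrow> ('x free_monoid \<Rightarrow>\<^sub>0 'k::field) set" where
  "act_kernel act X = {f \<in> carrier (free_algebra X). \<forall>h s. act_op act f h s = 0}"

text \<open>Pullback makes \<open>act_op\<close> an antihomomorphism; its kernel is a two-sided
  ideal all the same.\<close>

lemma alg_ideal_act_kernel:
  fixes act :: "'x \<Rightarrow> 's \<Rightarrow> 's option"
  shows "alg_ideal (act_kernel act X) (free_algebra X :: ('k::field, 'x free_monoid \<Rightarrow>\<^sub>0 'k) module)"
  unfolding alg_ideal_def rng_ideal_free_algebra_iff free_algebra_simps
proof (intro conjI ballI allI)
  fix f g :: "'x free_monoid \<Rightarrow>\<^sub>0 'k" assume f: "f \<in> act_kernel act X"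
  then have [simp]: "act_op act f h s = 0" for h s
    by (simp add: act_kernel_def)
  have [simp]: "act_op act f h = (\<lambda>_. 0)" for h
    by (simp add: fun_eq_iff)
  note f' = f[unfolded act_kernel_def, THEN CollectD, THEN conjunct1]
  show "f - g \<in> act_kernel act X" if "g \<in> act_kernel act X"
    using f' that by (simp add: act_kernel_def act_op_minus minus_in_free_algebra)
  show "g * f \<in> act_kernel act X" "f * g \<in> act_kernel act X" if "g \<in> carrier (free_algebra X)"
    using f' that by (simp_all add: act_kernel_def act_op_mult mult_in_free_algebra act_op_zero_right)
  show "Poly_Mapping.single 0 c * f \<in> act_kernel act X" for c
    using f' by (simp add: act_kernel_def act_op_mult scale_in_free_algebra)
qed (auto simp: act_kernel_def act_op_zero zero_in_free_algebra)

lemma act_op_monom_diff: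
  assumes "\<And>s. word_act act u s = word_act act w s"
  shows "act_op act (monom u 1 - monom w 1) h s = 0"
  using assms by (simp add: act_op_minus act_op_single word_op_def)

lemma act_op_monom_zero:
  assumes "\<And>s. word_act act u s = None"
  shows "act_op act (monom u 1) h s = 0"
  using assms by (simp add: act_op_single word_op_def)

context lpa
begin

text \<open>The empty list stands for the trivial path at \<open>p\<close>.\<close>

fun path_start :: "'a \<Rightarrow> 'b list \<Rightarrow> 'a" where
  "path_start p [] = p"
| "path_start p (e # \<alpha>) = tail G e"

text \<open>The arguments \<open>\<alpha>\<close> are meant to be paths ending at \<open>p\<close> all of whose vertices lie in \<open>Q\<close>, but
  the relations are respected on arbitrary lists of arcs.\<close>

fun path_act :: "'a \<Rightarrow> 'a set \<Rightarrow> ('a, 'b) lpa_gen \<Rightarrow> 'b list \<Rightarrow> 'b list option" where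
  "path_act p Q (Vert v) \<alpha> = (if v \<in> Q \<and> v = path_start p \<alpha> then Some \<alpha> else None)"
| "path_act p Q (Edge e) \<alpha> =
     (if head G e \<in> Q \<and> head G e = path_start p \<alpha> then Some (e # \<alpha>) else None)"
| "path_act p Q (Ghost e) [] = None"
| "path_act p Q (Ghost e) (f # \<alpha>) =
     (if f = e \<and> head G e \<in> Q \<and> head G e = path_start p \<alpha> then Some \<alpha> else None)"

text \<open>Without regular vertices, every relation compares a word with a word or with
  \<open>0\<close>, so it suffices to compare partial maps. Closure of \<open>Q\<close> under
  predecessors lets the tail of an edge \<open>e\<close> fix the lists \<open>e # \<alpha>\<close>
  once the head of \<open>e\<close> is in \<open>Q\<close>.\<close>

lemma lpa_ideal_path_kernel:
  assumes no_regular: "\<And>v. \<not> regular_vertex G v"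
    and Q: "\<And>e. \<lbrakk>e \<in> arcs G; head G e \<in> Q\<rbrakk> \<Longrightarrow> tail G e \<in> Q"
  shows "lpa_ideal G \<subseteq> (act_kernel (path_act p Q) (lpa_gens G) :: (_ \<Rightarrow>\<^sub>0 'k) set)"
proof -
  let ?a = "path_act p Q"
  have "act_op ?a r h \<alpha> = 0" if r: "r \<in> lpa_relations G" for r :: "_ \<Rightarrow>\<^sub>0 'k" and h \<alpha>
    using r unfolding lpa_relations_def Un_iff mem_Collect_eq
  proof (elim disjE exE conjE)
    fix v w
    assume r: "r = gen (Vert v) * gen (Vert w) - (if v = w then gen (Vert v) else 0)"
    show ?thesis
    proof (cases "v = w")
      case True
      have *: "word_act ?a [Vert w, Vert w] s = word_act ?a [Vert w] s" for s
        by auto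
      show ?thesis
        using act_op_monom_diff[OF *, of h \<alpha>] r True by (simp add: gen_def monom_mult)
    next
      case False
      then have *: "word_act ?a [Vert v, Vert w] s = None" for s
        by auto
      show ?thesis
        using act_op_monom_zero[OF *, of h \<alpha>] r False by (simp add: gen_def monom_mult)
    qed
  next
    fix e assume e: "e \<in> arcs G" and r: "r = gen (Vert (tail G e)) * gen (Edge e) - gen (Edge e)"
    have *: "word_act ?a [Vert (tail G e), Edge e] s = word_act ?a [Edge e] s" for s
      using Q[OF e] by auto
    show ?thesis
      using act_op_monom_diff[OF *, of h \<alpha>] r by (simp add: gen_def monom_mult)
  next
    fix e assume e: "e \<in> arcs G" and r: "r = gen (Edge e) * gen (Vert (head G e)) - gen (Edge e)"
    have *: "word_act ?a [Edge e, Vert (head G e)] s = word_act ?a [Edge e] s" for s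
      by auto
    show ?thesis
      using act_op_monom_diff[OF *, of h \<alpha>] r by (simp add: gen_def monom_mult)
  next
    fix e assume e: "e \<in> arcs G" and r: "r = gen (Vert (head G e)) * gen (Ghost e) - gen (Ghost e)"
    have *: "word_act ?a [Vert (head G e), Ghost e] s = word_act ?a [Ghost e] s" for s
      by (cases s) auto
    show ?thesis
      using act_op_monom_diff[OF *, of h \<alpha>] r by (simp add: gen_def monom_mult)
  next
    fix e assume e: "e \<in> arcs G" and r: "r = gen (Ghost e) * gen (Vert (tail G e)) - gen (Ghost e)"
    have *: "word_act ?a [Ghost e, Vert (tail G e)] s = word_act ?a [Ghost e] s" for s
    proof (cases "head G e \<in> Q")
      case True
      then have "tail G e \<in> Q"
        by (rule Q[OF e])
      then show ?thesis
        by (cases s) auto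
    next
      case False
      then show ?thesis
        by (cases s) auto
    qed
    show ?thesis
      using act_op_monom_diff[OF *, of h \<alpha>] r by (simp add: gen_def monom_mult)
  next
    fix e f
    assume r: "r = gen (Ghost e) * gen (Edge f) - (if e = f then gen (Vert (head G e)) else 0)"
    show ?thesis
    proof (cases "e = f")
      case True
      have *: "word_act ?a [Ghost f, Edge f] s = word_act ?a [Vert (head G f)] s" for s
        by auto
      show ?thesis
        using act_op_monom_diff[OF *, of h \<alpha>] r True by (simp add: gen_def monom_mult)
    next
      case False
      then have *: "word_act ?a [Ghost e, Edge f] s = None" for s
        by auto
      show ?thesis
        using act_op_monom_zero[OF *, of h \<alpha>] r False by (simp add: gen_def monom_mult)
    qed
  next
    fix v assume "regular_vertex G v"
    then show ?thesis
      using no_regular by blast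
  qed
  then have "lpa_relations G \<subseteq> (act_kernel ?a (lpa_gens G) :: (_ \<Rightarrow>\<^sub>0 'k) set)"
    using lpa_relations_carrier by (auto simp: act_kernel_def)
  then show ?thesis
    unfolding lpa_ideal_def alg_ideal_gen_def by (intro Inter_lower) (simp add: alg_ideal_act_kernel)
qed

lemma vert_in_path_kernel:
  assumes "v \<in> verts G" "v \<notin> Q"
  shows "gen (Vert v) \<in> (act_kernel (path_act p Q) (lpa_gens G) :: (_ \<Rightarrow>\<^sub>0 'k) set)"
  using assms by (simp add: act_kernel_def gen_def act_op_single word_op_def monom_in_free_algebra)

text \<open>A list starting at \<open>v\<close> is fixed by \<open>v\<close>, which the constant
  function \<open>1\<close> detects. Any \<open>e\<close> with tail \<open>v\<close> gives such a
  list, whether or not it is an arc.\<close>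

lemma vert_notin_path_kernel:
  assumes "v \<in> Q" "v = p \<or> (\<exists>e. tail G e = v)"
  shows "gen (Vert v) \<notin> (act_kernel (path_act p Q) (lpa_gens G) :: (_ \<Rightarrow>\<^sub>0 'k) set)"
proof -
  obtain \<alpha> where "path_act p Q (Vert v) \<alpha> = Some \<alpha>"
  proof (cases "v = p")
    case True
    then show ?thesis
      using that[of "[]"] assms by simp
  next
    case False
    then obtain e where "tail G e = v"
      using assms by blast
    then show ?thesis
      using that[of "[e]"] assms by simp
  qed
  then have "act_op (path_act p Q) (gen (Vert v)) (\<lambda>_. 1 :: 'k) \<alpha> = 1"
    by (simp add: gen_def act_op_single word_op_def)
  then show ?thesis
    by (force simp: act_kernel_def)
qed

end

section \<open>The graph of a poset\<close>

lemma poset_graph_simps [simp]: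
  "verts (poset_graph P) = P"
  "(i, p, q) \<in> arcs (poset_graph P) \<longleftrightarrow> p \<in> P \<and> q \<in> P \<and> q < p"
  "tail (poset_graph P) (i, p, q) = p"
  "head (poset_graph P) (i, p, q) = q"
  by (auto simp: poset_graph_def)

locale poset_lpa =
  fixes P :: "'p::order set" and K :: "'k::field itself"
begin

abbreviation E where "E \<equiv> poset_graph P"

sublocale lpa E K
  by unfold_locales (auto simp: poset_graph_def)

abbreviation A :: "('k, ('p, nat \<times> 'p \<times> 'p) lpa_gen free_monoid \<Rightarrow>\<^sub>0 'k) module" where
  "A \<equiv> free_algebra (lpa_gens E)"

abbreviation N :: "(('p, nat \<times> 'p \<times> 'p) lpa_gen free_monoid \<Rightarrow>\<^sub>0 'k) set" where
  "N \<equiv> lpa_ideal E"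

abbreviation vert :: "'p \<Rightarrow> (('p, nat \<times> 'p \<times> 'p) lpa_gen free_monoid \<Rightarrow>\<^sub>0 'k)" where
  "vert v \<equiv> gen (Vert v)"

text \<open>Every edge descends strictly; this also makes the graph acyclic.\<close>

lemma awalk_less:
  assumes "awalk v \<alpha> w" "\<alpha> \<noteq> []"
  shows "w < v"
  using assms
proof (induction \<alpha> arbitrary: v)
  case (Cons e \<alpha>)
  obtain i p q where e: "e = (i, p, q)"
    by (cases e)
  have *: "awalk q \<alpha> w" "q < v"
    using Cons.prems by (auto simp: awalk_Cons_iff e)
  show ?case
  proof (cases "\<alpha> = []")
    case True
    then show ?thesis
      using * by (simp add: awalk_Nil_iff)
  next
    case False
    then show ?thesis
      using Cons.IH * by force
  qed
qed simp

lemma awalk_edge: "\<lbrakk>p \<in> P; q \<in> P; q < p\<rbrakk> \<Longrightarrow> awalk p [(i, p, q)] q"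
  using arc_implies_awalk[of "(i, p, q)"] by simp

lemma vertices_above_poset:
  assumes "p \<in> P"
  shows "vertices_above E p = {q \<in> P. p \<le> q}"
proof -
  have "q \<rightarrow>\<^sup>*\<^bsub>E\<^esub> p \<longleftrightarrow> p \<le> q" if "q \<in> P" for q
  proof
    assume "q \<rightarrow>\<^sup>*\<^bsub>E\<^esub> p"
    then obtain \<alpha> where \<alpha>: "awalk q \<alpha> p"
      by (auto simp: reachable_awalk)
    show "p \<le> q"
    proof (cases "\<alpha> = []")
      case True
      then show ?thesis
        using \<alpha> by (simp add: awalk_Nil_iff)
    next
      case False
      then show ?thesis
        using awalk_less[OF \<alpha>] by simp
    qed
  next
    assume "p \<le> q"
    then have "q = p \<or> awalk q [(0, q, p)] p"
      using awalk_edge assms that by (auto simp: order.order_iff_strict)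
    then show "q \<rightarrow>\<^sup>*\<^bsub>E\<^esub> p"
      using assms by (auto intro: reachable_awalkI)
  qed
  then show ?thesis
    by (auto simp: vertices_above_def)
qed

text \<open>One edge out of \<open>v\<close> comes with infinitely many parallel copies.\<close>

lemma not_regular: "\<not> regular_vertex E v"
proof
  assume "regular_vertex E v"
  then have fin: "finite (out_arcs E v)" and "out_arcs E v \<noteq> {}"
    by (auto simp: regular_vertex_def)
  then obtain i q where "v \<in> P" "q \<in> P" "q < v"
    by (auto simp: out_arcs_def)
  then have "range (\<lambda>i. (i, v, q)) \<subseteq> out_arcs E v"
    by auto
  then have "finite (range (\<lambda>i::nat. (i, v, q)))"
    using fin finite_subset by blast
  moreover have "inj (\<lambda>i::nat. (i, v, q))"
    by (simp add: inj_def)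
  ultimately show False
    using finite_imageD infinite_UNIV_nat by blast
qed

lemma vert_carrier: "v \<in> P \<Longrightarrow> vert v \<in> carrier A"
  by (simp add: gen_def monom_in_free_algebra)

text \<open>\<open>phi p\<close> is the preimage of \<^term>\<open>poset_phi K P p\<close> in the free algebra.\<close>

definition phi :: "'p \<Rightarrow> (('p, nat \<times> 'p \<times> 'p) lpa_gen free_monoid \<Rightarrow>\<^sub>0 'k) set" where
  "phi p = rng_ideal_gen A (N \<union> vert ` {q \<in> P. \<not> p \<le> q})"

lemma phi_ideal: "rng_ideal (phi p) A"
  unfolding phi_def using vert_carrier rng_ideal_lpa_ideal
  by (intro free_algebra.rng_ideal_gen_ideal) (auto simp: rng_ideal_free_algebra_iff)

lemma N_subset_phi: "N \<subseteq> phi p"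
  using rng_ideal_gen_superset[of "N \<union> vert ` {q \<in> P. \<not> p \<le> q}" A] by (simp add: phi_def)

text \<open>The path representation on the up-set of \<open>p\<close> kills all generators of
  \<open>phi p\<close> but no vertex of that up-set, so these vertices stay outside
  \<open>phi p\<close>.\<close>

lemma vert_in_phi_iff:
  assumes "p \<in> P" "q \<in> P"
  shows "vert q \<in> phi p \<longleftrightarrow> \<not> p \<le> q"
proof
  assume q: "vert q \<in> phi p"
  let ?K = "act_kernel (path_act p {q. p \<le> q}) (lpa_gens E) :: (_ \<Rightarrow>\<^sub>0 'k) set"
  have "phi p \<subseteq> ?K"
    unfolding phi_def
  proof (rule rng_ideal_gen_least)
    show "rng_ideal ?K A"
      using alg_ideal_act_kernel by (auto simp: alg_ideal_def)
    have "N \<subseteq> ?K"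
      by (rule lpa_ideal_path_kernel[OF not_regular]) (auto intro: order_trans less_imp_le)
    then show "N \<union> vert ` {q \<in> P. \<not> p \<le> q} \<subseteq> ?K"
      using vert_in_path_kernel by auto
  qed
  then have "vert q \<in> ?K"
    using q by blast
  \<comment> \<open>\<open>(0, q, q)\<close> is not an arc; it serves as a list entry with tail
    \<open>q\<close>.\<close>
  moreover have "\<exists>e. tail E e = q"
    by (rule exI[of _ "(0, q, q)"]) simp
  ultimately show "\<not> p \<le> q"
    using vert_notin_path_kernel[of q "{q. p \<le> q}" p] by auto
next
  assume "\<not> p \<le> q"
  then show "vert q \<in> phi p"
    using assms rng_ideal_gen_superset[of "N \<union> vert ` {q \<in> P. \<not> p \<le> q}" A]
    by (auto simp: phi_def)
qed

text \<open>Verifies the conditions of \<open>corner\<close> whenever \<open>p\<close> lies below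
  all vertices outside \<open>I\<close>.\<close>

lemma corner_mod_ideal:
  assumes p: "p \<in> P" and I: "rng_ideal I A" "N \<subseteq> I" "\<And>q. \<lbrakk>q \<in> P; vert q \<notin> I\<rbrakk> \<Longrightarrow> p \<le> q"
    and f: "f \<in> carrier A" "f \<notin> I"
  shows "\<exists>a\<in>carrier A. \<exists>b\<in>carrier A. a * f * b - vert p \<in> I"
  unfolding gen_def
proof (rule corner[OF I(1,2) f])
  fix w \<rho> assume "awalk w \<rho> w"
  then show "\<rho> = []"
    using awalk_less by blast
next
  fix w and T :: "(nat \<times> 'p \<times> 'p) list set"
  assume w: "w \<in> verts E" "monom [Vert w] 1 \<notin> I" and T: "finite T"
  have pw: "p \<le> w"
    using I(3)[of w] w by (simp add: gen_def)
  show "\<exists>u. awalk w u p \<and> (\<forall>\<rho>\<in>T. \<forall>w'. \<rho> \<noteq> [] \<longrightarrow> awalk w \<rho> w' \<longrightarrow> monom [Vert w'] 1 \<notin> I \<longrightarrow>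
        \<not> prefix u \<rho> \<and> \<not> prefix \<rho> u)"
  proof (cases "w = p")
    case True
    \<comment> \<open>A nontrivial path out of \<open>p\<close> ends strictly below
      \<open>p\<close>, hence at a vertex in \<open>I\<close>; so the trivial path \<open>u\<close>
      has nothing to avoid.\<close>
    have False if "\<rho> \<noteq> []" "awalk w \<rho> w'" "monom [Vert w'] 1 \<notin> I" for \<rho> w'
    proof -
      have "w' < p"
        using awalk_less[OF that(2,1)] True by simp
      moreover have "p \<le> w'"
        using I(3)[of w'] that awalk_last_in_verts[OF that(2)] by (simp add: gen_def)
      ultimately show False
        by simp
    qed
    then show ?thesis
      using True p by (intro exI[of _ "[]"]) (auto simp: awalk_Nil_iff)
  next
    case False
    have "finite (fst ` (\<Union>\<rho>\<in>T. set \<rho>))"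
      using T by simp
    then obtain i where i: "i \<notin> fst ` (\<Union>\<rho>\<in>T. set \<rho>)"
      using ex_new_if_finite[OF infinite_UNIV_nat] by blast
    have "\<not> prefix [(i, w, p)] \<rho> \<and> \<not> prefix \<rho> [(i, w, p)]" if "\<rho> \<in> T" "\<rho> \<noteq> []" for \<rho>
    proof -
      have "(i, w, p) \<notin> set \<rho>"
        using i that(1) by force
      then show ?thesis
        using that(2) by (cases \<rho>) auto
    qed
    moreover have "awalk w [(i, w, p)] p"
      using False pw w p by (intro awalk_edge) auto
    ultimately show ?thesis
      by blast
  qed
qed

text \<open>From \<open>a f b = p\<close> and \<open>c g d = p\<close> modulo \<open>phi p\<close>
  it follows that \<open>a f (b c) g d = p p = p\<close>, which is nonzero there; so
  \<open>f (b c) g\<close> is not in \<open>phi p\<close>.\<close>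

lemma prime_phi:
  assumes p: "p \<in> P"
  shows "rng_prime_ideal (phi p) A"
  unfolding rng_prime_ideal_def
proof (intro conjI ballI impI)
  note minus = rng_ideal_free_algebraD(3)[OF phi_ideal] and mult = rng_ideal_free_algebraD(4,5)[OF phi_ideal]
  have vp: "vert p \<notin> phi p"
    using vert_in_phi_iff[OF p p] by simp
  show "rng_ideal (phi p) A"
    by (rule phi_ideal)
  show "phi p \<noteq> carrier A"
    using vp vert_carrier[OF p] by blast
  fix f g assume f: "f \<in> carrier A" and g: "g \<in> carrier A"
    and fg: "{f \<otimes>\<^bsub>A\<^esub> r \<otimes>\<^bsub>A\<^esub> g |r. r \<in> carrier A} \<subseteq> phi p"
  have up: "p \<le> q" if "q \<in> P" "vert q \<notin> phi p" for q
    using vert_in_phi_iff[OF p that(1)] that(2) by blast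
  note corner = corner_mod_ideal[OF p phi_ideal N_subset_phi up]
  show "f \<in> phi p \<or> g \<in> phi p"
  proof (rule ccontr)
    assume "\<not> (f \<in> phi p \<or> g \<in> phi p)"
    then have "f \<notin> phi p" "g \<notin> phi p"
      by simp_all
    obtain a b where ab: "a \<in> carrier A" "b \<in> carrier A" "a * f * b - vert p \<in> phi p"
      using corner[OF _ _ f \<open>f \<notin> phi p\<close>] by blast
    obtain c d where cd: "c \<in> carrier A" "d \<in> carrier A" "c * g * d - vert p \<in> phi p"
      using corner[OF _ _ g \<open>g \<notin> phi p\<close>] by blast
    have "b * c \<in> carrier A"
      using ab cd by (intro mult_in_free_algebra)
    then have "f * (b * c) * g \<in> phi p"
      using fg unfolding free_algebra_simps by blast
    then have "a * (f * (b * c) * g) * d \<in> phi p"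
      by (rule mult(2)[OF mult(1)[OF _ ab(1)] cd(2)])
    moreover have "(a * f * b - vert p) * (c * g * d) \<in> phi p"
      using cd g by (intro mult(2)[OF ab(3)] mult_in_free_algebra)
    moreover have "vert p * (c * g * d - vert p) \<in> phi p"
      by (rule mult(1)[OF cd(3) vert_carrier[OF p]])
    moreover have "vert p * vert p - vert p \<in> phi p"
    proof -
      have "vert p * vert p - vert p \<in> lpa_relations E"
        unfolding lpa_relations_def using p by (intro UnI1) (auto intro!: exI[of _ p])
      then show ?thesis
        using lpa_relations_subset N_subset_phi by blast
    qed
    \<comment> \<open>Telescoping: everything cancels except \<open>vert p\<close>.\<close>
    ultimately have "a * (f * (b * c) * g) * d - (a * f * b - vert p) * (c * g * d)
        - vert p * (c * g * d - vert p) - (vert p * vert p - vert p) \<in> phi p"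
      by (rule minus[OF minus[OF minus]])
    then show False
      using vp by (simp add: algebra_simps)
  qed
qed

text \<open>For the forward direction the vertex \<open>q\<close> is the test: it is outside
  \<open>phi q\<close>, hence outside \<open>phi p\<close>.\<close>

lemma phi_subset_iff:
  assumes "p \<in> P" "q \<in> P"
  shows "phi p \<subseteq> phi q \<longleftrightarrow> p \<le> q"
proof
  assume "phi p \<subseteq> phi q"
  then show "p \<le> q"
    using vert_in_phi_iff[of p q] vert_in_phi_iff[of q q] assms by auto
next
  assume "p \<le> q"
  then have "vert ` {r \<in> P. \<not> p \<le> r} \<subseteq> vert ` {r \<in> P. \<not> q \<le> r}"
    by (auto intro: order_trans)
  moreover have "N \<union> vert ` {r \<in> P. \<not> q \<le> r} \<subseteq> phi q"
    unfolding phi_def by (rule rng_ideal_gen_superset)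
  ultimately have "N \<union> vert ` {r \<in> P. \<not> p \<le> r} \<subseteq> phi q"
    by blast
  then show "phi p \<subseteq> phi q"
    unfolding phi_def[of p] by (rule rng_ideal_gen_least[OF phi_ideal])
qed

end

section \<open>Prime ideals and the descending chain condition\<close>

text \<open>Dependent choice in a set without minimal elements yields a strictly descending
  sequence, whose range is a chain forbidden by \<open>DCC_on\<close>.\<close>

lemma DCC_on_minimal:
  assumes DCC: "DCC_on P" and F: "F \<subseteq> P" "F \<noteq> {}"
  shows "\<exists>m\<in>F. \<forall>x\<in>F. \<not> x < m"
proof (rule ccontr)
  assume contr: "\<not> ?thesis"
  obtain x0 where "x0 \<in> F"
    using F by blast
  then have "\<exists>f. \<forall>n. f n \<in> F \<and> f (Suc n) < f n"
    using contr by (intro dependent_nat_choice) auto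
  then obtain f where f: "\<And>n. f n \<in> F" "\<And>n. f (Suc n) < f n"
    by blast
  have mono: "f n \<le> f m" if "m \<le> n" for m n :: nat
    using lift_Suc_antimono_le[of f, OF less_imp_le[OF f(2)] that] .
  have "Complete_Partial_Order.chain (\<le>) (range f)"
    unfolding chain_def using mono by (auto intro: nat_le_linear[THEN disjE])
  moreover have "\<not> (\<exists>m\<in>range f. \<forall>x\<in>range f. \<not> x < m)"
    using f(2) by auto
  ultimately show False
    using DCC F f(1) unfolding DCC_on_def by (metis empty_not_UNIV image_is_empty image_subset_iff subset_trans)
qed

context poset_lpa
begin

lemma prime_eq_phi:
  assumes DCC: "DCC_on P" and I: "rng_prime_ideal I A" "N \<subseteq> I"
  shows "\<exists>p\<in>P. I = phi p"
proof -
  have ideal: "rng_ideal I A" and proper: "I \<noteq> carrier A"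
    using I(1) by (simp_all add: rng_prime_ideal_def)
  note D = rng_ideal_free_algebraD[OF ideal]
  define F where "F = {q \<in> P. vert q \<notin> I}"
  have "F \<noteq> {}"
  proof
    assume "F = {}"
    then have "vert q \<in> I" if "q \<in> verts E" for q
      using that by (auto simp: F_def)
    then show False
      using ideal_all_verts[OF ideal I(2)] proper by blast
  qed
  then obtain m where m: "m \<in> F" "\<And>x. x \<in> F \<Longrightarrow> \<not> x < m"
    using DCC_on_minimal[OF DCC, of F] by (auto simp: F_def)
  then have mP: "m \<in> P" "vert m \<notin> I"
    by (auto simp: F_def)
  \<comment> \<open>Directedness gives a common lower bound \<open>w\<close> of \<open>m\<close> and
    \<open>q\<close> outside \<open>I\<close>, and minimality of \<open>m\<close> makes it equal to
    \<open>m\<close>.\<close>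
  have least: "m \<le> q" if q: "q \<in> P" "vert q \<notin> I" for q
  proof -
    obtain w \<alpha> \<beta> where w: "vert w \<notin> I" "awalk m \<alpha> w" "awalk q \<beta> w"
      using prime_ideal_verts_directed[OF I, of m q] mP q by auto
    have "w \<in> F"
      using w awalk_last_in_verts[OF w(2)] by (simp add: F_def)
    then have "\<not> w < m"
      by (rule m(2))
    then have "m = w"
      using awalk_less[OF w(2)] w(2) by (cases "\<alpha> = []") (auto simp: awalk_Nil_iff)
    then show ?thesis
      using awalk_less[OF w(3)] w(3) by (cases "\<beta> = []") (auto simp: awalk_Nil_iff)
  qed
  have sub: "phi m \<subseteq> I"
    unfolding phi_def using I(2) least by (intro rng_ideal_gen_least[OF ideal]) auto
  \<comment> \<open>An \<open>f\<close> in \<open>I\<close> but not in \<open>phi m\<close> would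
    give \<open>a f b = m\<close> modulo \<open>phi m\<close>, hence modulo \<open>I\<close>, and so
    put \<open>vert m\<close> into \<open>I\<close>.\<close>
  have "f \<in> phi m" if f: "f \<in> I" for f
  proof (rule ccontr)
    assume "f \<notin> phi m"
    moreover have fA: "f \<in> carrier A"
      using f D(1) by blast
    ultimately obtain a b where ab: "a \<in> carrier A" "b \<in> carrier A" "a * f * b - vert m \<in> phi m"
      using corner_mod_ideal[OF mP(1) phi_ideal N_subset_phi, of m f] vert_in_phi_iff[OF mP(1)] by blast
    have "a * f * b \<in> I"
      using D(5)[OF D(4)[OF f ab(1)] ab(2)] .
    moreover have "a * f * b - vert m \<in> I"
      using ab sub by blast
    ultimately have "a * f * b - (a * f * b - vert m) \<in> I"
      by (rule D(3))
    then show False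
      using mP by simp
  qed
  then show ?thesis
    using sub mP by blast
qed

text \<open>The witness is the intersection of the \<open>phi c\<close> over a chain
  \<open>C\<close> without minimal element. It is prime because two elements outside it are both
  outside one \<open>phi e\<close>, with \<open>e\<close> the smaller of two indices. If it were
  \<open>phi p\<close>, then \<open>p\<close> would lie below all of \<open>C\<close> and yet above
  some element of \<open>C\<close>, as \<open>vert p\<close> is missing from the
  intersection.\<close>

lemma prime_not_phi:
  assumes "\<not> DCC_on P"
  shows "\<exists>I. rng_prime_ideal I A \<and> N \<subseteq> I \<and> I \<notin> phi ` P"
proof -
  from assms obtain C where C: "C \<subseteq> P" "C \<noteq> {}" and "Complete_Partial_Order.chain (\<le>) C"
    and "\<not> (\<exists>m\<in>C. \<forall>x\<in>C. \<not> x < m)"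
    unfolding DCC_on_def not_not by (elim exE conjE)
  then have chain: "\<forall>x\<in>C. \<forall>y\<in>C. x \<le> y \<or> y \<le> x" and no_min: "\<forall>m\<in>C. \<exists>x\<in>C. x < m"
    by (simp_all add: chain_def)
  define I where "I = (\<Inter>c\<in>C. phi c)"
  have sub: "I \<subseteq> phi c" if "c \<in> C" for c
    using that by (auto simp: I_def)
  have "I \<subseteq> carrier A"
    using C(2) rng_ideal_free_algebraD(1)[OF phi_ideal] sub by blast
  then have ideal: "rng_ideal I A"
    unfolding rng_ideal_free_algebra_iff
    using phi_ideal[unfolded rng_ideal_free_algebra_iff] by (simp add: I_def)
  obtain c0 where c0: "c0 \<in> C" "c0 \<in> P"
    using C by blast
  have "I \<noteq> carrier A"
    using vert_carrier[of c0] vert_in_phi_iff[of c0 c0] sub[of c0] c0 by auto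
  moreover have "f \<in> I \<or> g \<in> I"
    if f: "f \<in> carrier A" and g: "g \<in> carrier A"
      and fg: "{f \<otimes>\<^bsub>A\<^esub> r \<otimes>\<^bsub>A\<^esub> g |r. r \<in> carrier A} \<subseteq> I" for f g
  proof (rule ccontr)
    assume "\<not> (f \<in> I \<or> g \<in> I)"
    then obtain c d where cd: "c \<in> C" "f \<notin> phi c" "d \<in> C" "g \<notin> phi d"
      by (auto simp: I_def)
    then obtain e where e: "e \<in> C" "e \<le> c" "e \<le> d"
      using chain by blast
    then have eP: "e \<in> P" "c \<in> P" "d \<in> P"
      using C(1) cd by auto
    then have "phi e \<subseteq> phi c" "phi e \<subseteq> phi d"
      using phi_subset_iff e by auto
    then have "f \<notin> phi e" "g \<notin> phi e"
      using cd by auto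
    moreover have "{f \<otimes>\<^bsub>A\<^esub> r \<otimes>\<^bsub>A\<^esub> g |r. r \<in> carrier A} \<subseteq> phi e"
      using fg sub[OF e(1)] by (rule subset_trans)
    ultimately show False
      using prime_phi[OF eP(1)] f g unfolding rng_prime_ideal_def by blast
  qed
  ultimately have "rng_prime_ideal I A"
    using ideal unfolding rng_prime_ideal_def by blast
  moreover have "N \<subseteq> I"
    using N_subset_phi by (auto simp: I_def)
  moreover have "I \<noteq> phi p" if p: "p \<in> P" for p
  proof
    assume eq: "I = phi p"
    then have "vert p \<notin> I"
      using vert_in_phi_iff[OF p p] by simp
    then obtain c where c: "c \<in> C" "vert p \<notin> phi c"
      by (auto simp: I_def)
    then have "c \<le> p"
      using vert_in_phi_iff[of c p] C(1) p by auto
    obtain d where d: "d \<in> C" "d < c"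
      using no_min c(1) by blast
    then have "p \<le> d"
      using phi_subset_iff[of p d] p C(1) sub[of d] eq by auto
    then show False
      using \<open>c \<le> p\<close> d by simp
  qed
  ultimately show ?thesis
    by blast
qed

section \<open>Passage to the Leavitt path algebra\<close>

interpretation Q: rng_quotient A N
  by (intro rng_quotient.intro free_algebra_nonunital_ring rng_quotient_axioms.intro rng_ideal_lpa_ideal)

text \<open>\<open>quot_alg\<close> adds only a scalar multiplication to the record
  \<open>A Quot N\<close>, and ring ideals do not refer to it.\<close>

lemma rng_ideal_quot_alg: "rng_ideal J (quot_alg A N) \<longleftrightarrow> rng_ideal J (A Quot N)"
  by (simp add: rng_ideal_def additive_subgroup_def subgroup_def m_inv_def quot_alg_def ring.defs FactRing_def)

lemma rng_Spec_lpa: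
  "rng_Spec (leavitt_path_algebra K E) = (\<lambda>I. (+>\<^bsub>A\<^esub>) N ` I) ` {I. rng_prime_ideal I A \<and> N \<subseteq> I}"
proof -
  have "rng_Spec (leavitt_path_algebra K E) = rng_Spec (A Quot N)"
    unfolding leavitt_path_algebra_def rng_Spec_def rng_prime_ideal_def rng_ideal_quot_alg
    by (simp add: quot_alg_def ring.defs)
  then show ?thesis
    unfolding Q.rng_Spec_quot by (simp add: rng_Spec_def)
qed

text \<open>Having \<open>N\<close> among its generators, \<open>phi p\<close> matches the form of
  \<open>rng_ideal_gen_quot\<close>.\<close>

lemma poset_phi_eq:
  assumes "p \<in> P"
  shows "poset_phi K P p = (+>\<^bsub>A\<^esub>) N ` phi p"
proof -
  let ?X = "{q \<in> P. \<not> p \<le> q}"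
  have X: "verts E - vertices_above E p = ?X"
    using vertices_above_poset[OF assms] by auto
  have "poset_phi K P p = rng_ideal_gen (A Quot N) (lpa_vertex E ` ?X)"
    unfolding poset_phi_def X leavitt_path_algebra_def rng_ideal_gen_def rng_ideal_quot_alg ..
  also have "lpa_vertex E ` ?X = (+>\<^bsub>A\<^esub>) N ` vert ` ?X"
    by (simp add: lpa_vertex_def image_image)
  also have "rng_ideal_gen (A Quot N) \<dots> = (+>\<^bsub>A\<^esub>) N ` phi p"
    unfolding phi_def using vert_carrier by (intro Q.rng_ideal_gen_quot) auto
  finally show ?thesis .
qed

lemma order_embedding_poset_phi:
  "order_embedding_on P (rng_Spec (leavitt_path_algebra K E)) (poset_phi K P)"
  unfolding order_embedding_on_def rng_Spec_lpa
proof (intro conjI funcsetI ballI)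
  fix p assume "p \<in> P"
  then show "poset_phi K P p \<in> (\<lambda>I. (+>\<^bsub>A\<^esub>) N ` I) ` {I. rng_prime_ideal I A \<and> N \<subseteq> I}"
    using prime_phi N_subset_phi by (auto simp: poset_phi_eq)
next
  fix p q assume "p \<in> P" "q \<in> P"
  then show "p \<le> q \<longleftrightarrow> poset_phi K P p \<subseteq> poset_phi K P q"
    using Q.image_coset_subset_iff[OF phi_ideal phi_ideal N_subset_phi] phi_subset_iff
    by (simp add: poset_phi_eq)
qed

text \<open>Passing from an ideal that contains \<open>N\<close> to its image is injective, so
  surjectivity can be decided in the free algebra.\<close>

lemma image_poset_phi_iff_DCC:
  "poset_phi K P ` P = rng_Spec (leavitt_path_algebra K E) \<longleftrightarrow> DCC_on P"
proof -
  let ?S = "{I. rng_prime_ideal I A \<and> N \<subseteq> I}"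
  have "inj_on (\<lambda>I. (+>\<^bsub>A\<^esub>) N ` I) ?S"
  proof (rule inj_onI)
    fix I J assume "I \<in> ?S" "J \<in> ?S" "(+>\<^bsub>A\<^esub>) N ` I = (+>\<^bsub>A\<^esub>) N ` J"
    then show "I = J"
      using Q.image_coset_subset_iff[of I J] Q.image_coset_subset_iff[of J I]
      by (simp add: rng_prime_ideal_def)
  qed
  moreover have phi: "phi ` P \<subseteq> ?S"
    using prime_phi N_subset_phi by auto
  moreover have "poset_phi K P ` P = (\<lambda>I. (+>\<^bsub>A\<^esub>) N ` I) ` phi ` P"
    by (simp add: image_image poset_phi_eq)
  ultimately have "poset_phi K P ` P = rng_Spec (leavitt_path_algebra K E) \<longleftrightarrow> phi ` P = ?S"
    unfolding rng_Spec_lpa by (simp add: inj_on_image_eq_iff)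
  also have "\<dots> \<longleftrightarrow> DCC_on P"
    using phi prime_eq_phi prime_not_phi by blast
  finally show ?thesis .
qed

end

lemma order_embedding_on_inj_on: "order_embedding_on A B f \<Longrightarrow> inj_on f A"
  by (auto simp: order_embedding_on_def intro!: inj_onI order.antisym)

theorem proposition13:
  fixes P :: "'p::order set"
  assumes "P \<noteq> {}"
  shows
    "order_embedding_on P (rng_Spec (leavitt_path_algebra TYPE('k::field) (poset_graph P)))
       (poset_phi TYPE('k) P) \<and>
     (order_isomorphism_on P (rng_Spec (leavitt_path_algebra TYPE('k) (poset_graph P)))
        (poset_phi TYPE('k) P) \<longleftrightarrow>
      DCC_on P)"
proof -
  interpret poset_lpa P "TYPE('k)" .
  \<comment> \<open>An order-embedding is injective by antisymmetry, so only surjectivity is left to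
    decide.\<close>
  note embedding = order_embedding_poset_phi
  then show ?thesis
    unfolding order_isomorphism_on_def bij_betw_def
    using order_embedding_on_inj_on[OF embedding] image_poset_phi_iff_DCC by blast
qed

end
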